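(* Let $n,k\ge 0$ be integers. For every $i\ge 2$ there is a constant $K_i$, depending on $n$, $k$ and $i$ but independent of the prime $p$ and of the multidegree $\mathbf{m}$, such that $$\dim_{\mathbb{F}_p}B_i(A_{n,k}(\mathbb{F}_p))[\mathbf{m}]\le K_i$$ for all primes $p$ and all $\mathbf{m}\in\mathbb{Z}_{\ge 0}^{n+k}$.
   Context: For a commutative ring $R$, $A_{n,k}(R)$ is the free associative unital $R$-algebra on $n$ even generators $x_1,\dots,x_n$ and $k$ odd generators $y_1,\dots,y_k$, graded by multidegree in the $n+k$ generators; $[\mathbf{m}]$ denotes the component of multidegree $\mathbf{m}$. The (super)commutator is the bilinear extension of $[a,b]=ab-(-1)^{d_ad_b}ba$ for words $a,b$, where $d_a$ is the number of odd generators $y_j$ in the word $a$, counted with multiplicity. With $A=A_{n,k}(R)$ and this bracket, $L_1=A$, $L_{i+1}=[A,L_i]$ (the $R$-span of the brackets), $B_i=L_i/L_{i+1}$. *)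

theory Defs
  imports "HOL-Number_Theory.Residues" "Jordan_Normal_Form.Missing_VectorSpace"
begin

section \<open>The free superalgebra\<close>

datatype gen = EvenGen nat | OddGen nat

definition gens :: "nat \<Rightarrow> nat \<Rightarrow> gen set" where
  "gens n k = EvenGen ` {..<n} \<union> OddGen ` {..<k}"

fun is_odd_gen :: "gen \<Rightarrow> bool" where
  "is_odd_gen (EvenGen i) = False"
| "is_odd_gen (OddGen j) = True"

definition odd_count :: "gen list \<Rightarrow> nat" where
  "odd_count w = length (filter is_odd_gen w)"

definition supp :: "('r, 's) ring_scheme \<Rightarrow> (gen list \<Rightarrow> 'r) \<Rightarrow> gen list set" where
  "supp R a = {w. a w \<noteq> \<zero>\<^bsub>R\<^esub>}"

text \<open>
  An element of the free algebra is represented by its coefficient function on words; the product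
  is the convolution induced by concatenation of words.
\<close>

definition free_alg :: "('r, 's) ring_scheme \<Rightarrow> nat \<Rightarrow> nat \<Rightarrow> ('r, gen list \<Rightarrow> 'r) module" where
  "free_alg R n k =
    \<lparr>carrier = {a. (\<forall>w. a w \<in> carrier R) \<and> finite (supp R a) \<and> supp R a \<subseteq> lists (gens n k)},
     monoid.mult = (\<lambda>a b w. \<Oplus>\<^bsub>R\<^esub>i\<in>{..length w}. a (take i w) \<otimes>\<^bsub>R\<^esub> b (drop i w)),
     one = (\<lambda>w. if w = [] then \<one>\<^bsub>R\<^esub> else \<zero>\<^bsub>R\<^esub>),
     zero = (\<lambda>w. \<zero>\<^bsub>R\<^esub>),
     add = (\<lambda>a b w. a w \<oplus>\<^bsub>R\<^esub> b w),
     smult = (\<lambda>r a w. r \<otimes>\<^bsub>R\<^esub> a w)\<rparr>"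

definition word :: "('r, 's) ring_scheme \<Rightarrow> gen list \<Rightarrow> gen list \<Rightarrow> 'r" where
  "word R u = (\<lambda>w. if w = u then \<one>\<^bsub>R\<^esub> else \<zero>\<^bsub>R\<^esub>)"

text \<open>
  The multidegree is a function on generators; only its values on \<^term>\<open>gens n k\<close> matter.
\<close>

definition homog :: "('r, 's) ring_scheme \<Rightarrow> nat \<Rightarrow> nat \<Rightarrow> (gen \<Rightarrow> nat) \<Rightarrow> (gen list \<Rightarrow> 'r) set" where
  "homog R n k m = {a \<in> carrier (free_alg R n k).
     \<forall>w\<in>supp R a. \<forall>g\<in>gens n k. count_list w g = m g}"

section \<open>The supercommutator and the lower central series\<close>

definition word_bracket ::
  "('r, 's) ring_scheme \<Rightarrow> nat \<Rightarrow> nat \<Rightarrow> gen list \<Rightarrow> gen list \<Rightarrow> gen list \<Rightarrow> 'r" where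
  "word_bracket R n k u v =
     (word R u \<otimes>\<^bsub>free_alg R n k\<^esub> word R v) \<ominus>\<^bsub>free_alg R n k\<^esub>
     (((\<ominus>\<^bsub>R\<^esub> \<one>\<^bsub>R\<^esub>) [^]\<^bsub>R\<^esub> (odd_count u * odd_count v)) \<odot>\<^bsub>free_alg R n k\<^esub>
       (word R v \<otimes>\<^bsub>free_alg R n k\<^esub> word R u))"

definition sbracket ::
  "('r, 's) ring_scheme \<Rightarrow> nat \<Rightarrow> nat \<Rightarrow> (gen list \<Rightarrow> 'r) \<Rightarrow> (gen list \<Rightarrow> 'r) \<Rightarrow> gen list \<Rightarrow> 'r" where
  "sbracket R n k a b =
     (\<Oplus>\<^bsub>free_alg R n k\<^esub>uv \<in> supp R a \<times> supp R b.
        (a (fst uv) \<otimes>\<^bsub>R\<^esub> b (snd uv)) \<odot>\<^bsub>free_alg R n k\<^esub> word_bracket R n k (fst uv) (snd uv))"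

text \<open>The series starts at index 1; the value at index 0 is a dummy.\<close>

fun lcs :: "('r, 's) ring_scheme \<Rightarrow> nat \<Rightarrow> nat \<Rightarrow> nat \<Rightarrow> (gen list \<Rightarrow> 'r) set" where
  "lcs R n k 0 = carrier (free_alg R n k)"
| "lcs R n k (Suc 0) = carrier (free_alg R n k)"
| "lcs R n k (Suc (Suc i)) = module.span R (free_alg R n k)
     {sbracket R n k a b | a b. a \<in> carrier (free_alg R n k) \<and> b \<in> lcs R n k (Suc i)}"

section \<open>The successive quotients and their graded components\<close>

text \<open>
  The record type forces a multiplication and a unit; they carry no meaning for the quotient
  of modules.
\<close>

definition quotient_module :: "('r, 'a, 't) module_scheme \<Rightarrow> 'a set \<Rightarrow> ('r, 'a set) module" where
  "quotient_module M H =
    \<lparr>carrier = a_rcosets\<^bsub>M\<^esub> H,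
     monoid.mult = (\<lambda>_ _. H),
     one = H,
     zero = H,
     add = set_add M,
     smult = (\<lambda>r C. \<Union>x\<in>C. H +>\<^bsub>M\<^esub> (r \<odot>\<^bsub>M\<^esub> x))\<rparr>"

definition Bquot :: "('r, 's) ring_scheme \<Rightarrow> nat \<Rightarrow> nat \<Rightarrow> nat \<Rightarrow> ('r, (gen list \<Rightarrow> 'r) set) module" where
  "Bquot R n k i = quotient_module ((free_alg R n k)\<lparr>carrier := lcs R n k i\<rparr>) (lcs R n k (Suc i))"

text \<open>
  The component of multidegree \<open>m\<close> of the quotient consists of the classes of the homogeneous
  elements of multidegree \<open>m\<close>.
\<close>

definition Bquot_comp ::
  "('r, 's) ring_scheme \<Rightarrow> nat \<Rightarrow> nat \<Rightarrow> nat \<Rightarrow> (gen \<Rightarrow> nat) \<Rightarrow> ('r, (gen list \<Rightarrow> 'r) set) module" where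
  "Bquot_comp R n k i m =
     (Bquot R n k i)\<lparr>carrier :=
        (\<lambda>a. lcs R n k (Suc i) +>\<^bsub>free_alg R n k\<^esub> a) ` (lcs R n k i \<inter> homog R n k m)\<rparr>"

section \<open>Well-definedness\<close>

context cring
begin

lemma free_alg_simps [simp]:
  "\<zero>\<^bsub>free_alg R n k\<^esub> = (\<lambda>w. \<zero>)"
  "a \<oplus>\<^bsub>free_alg R n k\<^esub> b = (\<lambda>w. a w \<oplus> b w)"
  "r \<odot>\<^bsub>free_alg R n k\<^esub> a = (\<lambda>w. r \<otimes> a w)"
  "a \<otimes>\<^bsub>free_alg R n k\<^esub> b = (\<lambda>w. \<Oplus>i\<in>{..length w}. a (take i w) \<otimes> b (drop i w))"
  by (simp_all add: free_alg_def)

lemma free_alg_carrier: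
  "a \<in> carrier (free_alg R n k) \<longleftrightarrow>
     (\<forall>w. a w \<in> carrier R) \<and> finite (supp R a) \<and> supp R a \<subseteq> lists (gens n k)"
  by (simp add: free_alg_def)

lemma free_alg_carrierI:
  assumes "\<And>w. a w \<in> carrier R" "supp R a \<subseteq> S" "finite S" "S \<subseteq> lists (gens n k)"
  shows "a \<in> carrier (free_alg R n k)"
  unfolding free_alg_carrier using assms finite_subset by blast

lemma free_alg_add_closed:
  assumes "a \<in> carrier (free_alg R n k)" "b \<in> carrier (free_alg R n k)"
  shows "(\<lambda>w. a w \<oplus> b w) \<in> carrier (free_alg R n k)"
proof (rule free_alg_carrierI[where S = "supp R a \<union> supp R b"])
  show "supp R (\<lambda>w. a w \<oplus> b w) \<subseteq> supp R a \<union> supp R b"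
    unfolding supp_def by auto
qed (use assms in \<open>auto simp: free_alg_carrier\<close>)

lemma free_alg_smult_closed:
  assumes "r \<in> carrier R" "a \<in> carrier (free_alg R n k)"
  shows "(\<lambda>w. r \<otimes> a w) \<in> carrier (free_alg R n k)"
proof (rule free_alg_carrierI[where S = "supp R a"])
  show "supp R (\<lambda>w. r \<otimes> a w) \<subseteq> supp R a"
    using assms unfolding supp_def by auto
qed (use assms in \<open>auto simp: free_alg_carrier\<close>)

lemma free_alg_mult_closed:
  assumes a: "a \<in> carrier (free_alg R n k)" and b: "b \<in> carrier (free_alg R n k)"
  shows "a \<otimes>\<^bsub>free_alg R n k\<^esub> b \<in> carrier (free_alg R n k)"
proof (rule free_alg_carrierI[where S = "(\<lambda>(u, v). u @ v) ` (supp R a \<times> supp R b)"])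
  have ab: "a w \<in> carrier R" "b w \<in> carrier R" for w
    using a b by (auto simp: free_alg_carrier)
  show "(a \<otimes>\<^bsub>free_alg R n k\<^esub> b) w \<in> carrier R" for w
    using ab by (simp add: finsum_closed Pi_def)
  show "supp R (a \<otimes>\<^bsub>free_alg R n k\<^esub> b) \<subseteq> (\<lambda>(u, v). u @ v) ` (supp R a \<times> supp R b)"
  proof
    fix w assume w: "w \<in> supp R (a \<otimes>\<^bsub>free_alg R n k\<^esub> b)"
    have "\<exists>i\<in>{..length w}. a (take i w) \<otimes> b (drop i w) \<noteq> \<zero>"
    proof (rule ccontr)
      assume "\<not> ?thesis"
      then have "(\<Oplus>i\<in>{..length w}. a (take i w) \<otimes> b (drop i w)) = (\<Oplus>i\<in>{..length w}. \<zero>)"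
        by (intro finsum_cong') auto
      then show False using w by (simp add: supp_def)
    qed
    then obtain i where "a (take i w) \<otimes> b (drop i w) \<noteq> \<zero>" by blast
    then have "a (take i w) \<noteq> \<zero>" "b (drop i w) \<noteq> \<zero>" using ab by auto
    then have "(take i w, drop i w) \<in> supp R a \<times> supp R b" by (simp add: supp_def)
    then show "w \<in> (\<lambda>(u, v). u @ v) ` (supp R a \<times> supp R b)"
      by (rule rev_image_eqI) simp
  qed
  show "(\<lambda>(u, v). u @ v) ` (supp R a \<times> supp R b) \<subseteq> lists (gens n k)"
  proof
    fix w assume "w \<in> (\<lambda>(u, v). u @ v) ` (supp R a \<times> supp R b)"
    then obtain u v where "u \<in> supp R a" "v \<in> supp R b" and w: "w = u @ v" by auto
    then have "u \<in> lists (gens n k)" "v \<in> lists (gens n k)"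
      using a b unfolding free_alg_carrier by blast+
    then show "w \<in> lists (gens n k)" unfolding w by simp
  qed
qed (use a b in \<open>auto simp: free_alg_carrier\<close>)

lemma word_closed:
  assumes "u \<in> lists (gens n k)"
  shows "word R u \<in> carrier (free_alg R n k)"
proof (rule free_alg_carrierI[where S = "{u}"])
  show "supp R (word R u) \<subseteq> {u}" by (auto simp: supp_def word_def)
qed (use assms in \<open>auto simp: word_def\<close>)

lemma free_alg_abelian_group: "abelian_group (free_alg R n k)"
proof (rule abelian_groupI)
  fix a assume a: "a \<in> carrier (free_alg R n k)"
  have aR: "a w \<in> carrier R" for w using a by (auto simp: free_alg_carrier)
  have "(\<lambda>w. (\<ominus> \<one>) \<otimes> a w) \<in> carrier (free_alg R n k)"
    using a by (intro free_alg_smult_closed) auto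
  moreover have "(\<lambda>w. (\<ominus> \<one>) \<otimes> a w) \<oplus>\<^bsub>free_alg R n k\<^esub> a = \<zero>\<^bsub>free_alg R n k\<^esub>"
    using aR by (simp add: l_minus l_neg)
  ultimately show "\<exists>b\<in>carrier (free_alg R n k). b \<oplus>\<^bsub>free_alg R n k\<^esub> a = \<zero>\<^bsub>free_alg R n k\<^esub>"
    by blast
next
  show "\<zero>\<^bsub>free_alg R n k\<^esub> \<in> carrier (free_alg R n k)"
    by (auto simp: free_alg_carrier supp_def)
next
  show "a \<oplus>\<^bsub>free_alg R n k\<^esub> b \<in> carrier (free_alg R n k)"
    if "a \<in> carrier (free_alg R n k)" "b \<in> carrier (free_alg R n k)" for a b
    using free_alg_add_closed[OF that] by simp
  show "a \<oplus>\<^bsub>free_alg R n k\<^esub> b = b \<oplus>\<^bsub>free_alg R n k\<^esub> a"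
    if "a \<in> carrier (free_alg R n k)" "b \<in> carrier (free_alg R n k)" for a b
    using that by (simp add: free_alg_carrier a_comm)
qed (simp_all add: free_alg_carrier a_assoc)

lemma free_alg_module: "module R (free_alg R n k)"
proof (rule moduleI)
  show "cring R" by (rule is_cring)
  show "abelian_group (free_alg R n k)" by (rule free_alg_abelian_group)
  show "r \<odot>\<^bsub>free_alg R n k\<^esub> a \<in> carrier (free_alg R n k)"
    if "r \<in> carrier R" "a \<in> carrier (free_alg R n k)" for r a
    using free_alg_smult_closed[OF that] by simp
qed (auto simp: free_alg_carrier l_distr r_distr m_assoc)

lemma word_mult: "word R u \<otimes>\<^bsub>free_alg R n k\<^esub> word R v = word R (u @ v)"
proof
  fix w
  have "(word R u \<otimes>\<^bsub>free_alg R n k\<^esub> word R v) w =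
      (\<Oplus>i\<in>{..length w}. if i = length u then (if w = u @ v then \<one> else \<zero>) else \<zero>)"
    unfolding free_alg_simps
  proof (rule finsum_cong')
    fix i assume i: "i \<in> {..length w}"
    show "word R u (take i w) \<otimes> word R v (drop i w) =
        (if i = length u then (if w = u @ v then \<one> else \<zero>) else \<zero>)"
    proof (cases "take i w = u \<and> drop i w = v")
      case True
      then have "w = u @ v" "i = length u" using i by (auto simp: min_def)
      then show ?thesis by (simp add: word_def)
    next
      case False
      then have "\<not> (i = length u \<and> w = u @ v)" by auto
      with False show ?thesis by (auto simp: word_def)
    qed
  qed auto
  also have "\<dots> = word R (u @ v) w"
  proof (cases "w = u @ v")
    case True
    then have "length u \<in> {..length w}" by simp
    then have "(\<Oplus>i\<in>{..length w}. if length u = i then \<one> else \<zero>) = \<one>"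
      by (intro add.finprod_singleton[where f = "\<lambda>_. \<one>"]) auto
    moreover have "(\<Oplus>i\<in>{..length w}. if i = length u then (if w = u @ v then \<one> else \<zero>) else \<zero>)
        = (\<Oplus>i\<in>{..length w}. if length u = i then \<one> else \<zero>)"
      using True by (intro finsum_cong') auto
    ultimately show ?thesis using True by (simp add: word_def)
  next
    case False
    then have "(\<Oplus>i\<in>{..length w}. if i = length u then (if w = u @ v then \<one> else \<zero>) else \<zero>)
        = (\<Oplus>i\<in>{..length w}. \<zero>)"
      by (intro finsum_cong') auto
    then show ?thesis using False by (simp add: word_def)
  qed
  finally show "(word R u \<otimes>\<^bsub>free_alg R n k\<^esub> word R v) w = word R (u @ v) w" .
qed

lemma word_bracket_closed:
  assumes "u \<in> lists (gens n k)" "v \<in> lists (gens n k)"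
  shows "word_bracket R n k u v \<in> carrier (free_alg R n k)"
proof -
  interpret A: module R "free_alg R n k" by (rule free_alg_module)
  show ?thesis unfolding word_bracket_def
    by (intro A.minus_closed A.smult_closed free_alg_mult_closed word_closed assms) simp
qed

lemma sbracket_closed:
  assumes "a \<in> carrier (free_alg R n k)" "b \<in> carrier (free_alg R n k)"
  shows "sbracket R n k a b \<in> carrier (free_alg R n k)"
proof -
  interpret A: module R "free_alg R n k" by (rule free_alg_module)
  show ?thesis unfolding sbracket_def
    by (intro A.finsum_closed Pi_I A.smult_closed word_bracket_closed m_closed)
       (use assms in \<open>auto simp: free_alg_carrier\<close>)
qed

lemma sbracket_word:
  assumes "\<one> \<noteq> \<zero>" "u \<in> lists (gens n k)" "v \<in> lists (gens n k)"
  shows "sbracket R n k (word R u) (word R v) = word_bracket R n k u v"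
proof -
  interpret A: module R "free_alg R n k" by (rule free_alg_module)
  have s: "supp R (word R w) = {w}" for w using assms(1) by (auto simp: supp_def word_def)
  have c: "word_bracket R n k u v \<in> carrier (free_alg R n k)"
    using assms by (simp add: word_bracket_closed)
  have "sbracket R n k (word R u) (word R v) =
      (\<one> \<otimes> \<one>) \<odot>\<^bsub>free_alg R n k\<^esub> word_bracket R n k u v"
    unfolding sbracket_def s
    using A.smult_closed[OF one_closed c]
    by (simp add: word_def Pi_def del: free_alg_simps)
  then show ?thesis using A.smult_one[OF c] by (simp del: free_alg_simps)
qed

lemma lcs_submodule: "LinearCombinations.submodule R (lcs R n k i) (free_alg R n k)"
  and lcs_subset: "lcs R n k i \<subseteq> carrier (free_alg R n k)"
proof -
  interpret A: module R "free_alg R n k" by (rule free_alg_module)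
  have *: "LinearCombinations.submodule R (carrier (free_alg R n k)) (free_alg R n k)"
    by (rule LinearCombinations.submodule.intro)
       (rule free_alg_module subset_refl A.M.add.m_closed A.M.zero_closed A.smult_closed; assumption?)+
  have "LinearCombinations.submodule R (lcs R n k i) (free_alg R n k) \<and>
        lcs R n k i \<subseteq> carrier (free_alg R n k)"
  proof (induction i rule: nat_less_induct)
    case (1 i)
    show ?case
    proof (cases "i = 0 \<or> i = 1")
      case True
      then show ?thesis using * by auto
    next
      case False
      then obtain j where j: "i = Suc (Suc j)" by (metis One_nat_def not0_implies_Suc)
      have "lcs R n k (Suc j) \<subseteq> carrier (free_alg R n k)"
        using 1 j by blast
      then have "{sbracket R n k a b | a b. a \<in> carrier (free_alg R n k) \<and> b \<in> lcs R n k (Suc j)}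
          \<subseteq> carrier (free_alg R n k)"
        using sbracket_closed by blast
      from A.span_is_submodule[OF this] A.span_is_subset2[OF this] show ?thesis
        unfolding j lcs.simps(3) by (rule conjI)
    qed
  qed
  then show "LinearCombinations.submodule R (lcs R n k i) (free_alg R n k)"
    "lcs R n k i \<subseteq> carrier (free_alg R n k)" by auto
qed

lemma lcs_Suc_subset: "lcs R n k (Suc i) \<subseteq> lcs R n k i"
proof (induction i)
  case 0
  then show ?case by simp
next
  case (Suc i)
  interpret A: module R "free_alg R n k" by (rule free_alg_module)
  show ?case
  proof (cases i)
    case 0
    then show ?thesis using lcs_subset[of n k "Suc (Suc 0)"] by simp
  next
    case (Suc j)
    have "lcs R n k (Suc (Suc j)) \<subseteq> lcs R n k (Suc j)" using Suc.IH Suc by simp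
    then show ?thesis
      unfolding Suc lcs.simps(3)[of R n k "Suc j"] lcs.simps(3)[of R n k j]
      by (intro A.span_is_monotone) (use lcs.simps(3)[of R n k j] in blast)
  qed
qed

end

lemma (in module) submodule_abelian_subgroup:
  assumes "LinearCombinations.submodule R H M"
  shows "abelian_subgroup H M"
proof (rule abelian_subgroupI3)
  interpret H: LinearCombinations.submodule R H M by (rule assms)
  have inv: "\<ominus>\<^bsub>M\<^esub> x \<in> H" if "x \<in> H" for x
  proof -
    have "(\<ominus> \<one>) \<odot>\<^bsub>M\<^esub> x \<in> H" using that by (intro H.smult_closed) auto
    moreover have "(\<ominus> \<one>) \<odot>\<^bsub>M\<^esub> x = \<ominus>\<^bsub>M\<^esub> x"
      using that H.subset by (subst smult_l_minus) auto
    ultimately show ?thesis by simp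
  qed
  show "additive_subgroup H M"
    by (intro additive_subgroup.intro add.subgroupI)
       (use H.subset H.zero_closed inv in \<open>auto simp: a_inv_def simp del: H.zero_closed\<close>)
qed (rule M.abelian_group_axioms)

lemma (in module) smult_coset:
  assumes H: "LinearCombinations.submodule R H M"
    and r: "r \<in> carrier R" and x: "x \<in> carrier M"
  shows "r \<odot>\<^bsub>quotient_module M H\<^esub> (H +>\<^bsub>M\<^esub> x) = H +>\<^bsub>M\<^esub> (r \<odot>\<^bsub>M\<^esub> x)"
proof -
  interpret H: LinearCombinations.submodule R H M by (rule H)
  interpret S: abelian_subgroup H M by (rule submodule_abelian_subgroup[OF H])
  have "H +>\<^bsub>M\<^esub> (r \<odot>\<^bsub>M\<^esub> y) = H +>\<^bsub>M\<^esub> (r \<odot>\<^bsub>M\<^esub> x)" if y: "y \<in> H +>\<^bsub>M\<^esub> x" for y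
  proof -
    from y obtain h where h: "h \<in> H" "y = h \<oplus>\<^bsub>M\<^esub> x" by (auto simp: a_r_coset_def')
    have hM: "h \<in> carrier M" using h H.subset by auto
    have "r \<odot>\<^bsub>M\<^esub> y = r \<odot>\<^bsub>M\<^esub> h \<oplus>\<^bsub>M\<^esub> r \<odot>\<^bsub>M\<^esub> x"
      using h hM r x by (simp add: smult_r_distr)
    moreover have "r \<odot>\<^bsub>M\<^esub> h \<in> H" using h r by auto
    ultimately have "r \<odot>\<^bsub>M\<^esub> y \<in> H +>\<^bsub>M\<^esub> (r \<odot>\<^bsub>M\<^esub> x)" by (auto simp: a_r_coset_def')
    then show ?thesis
      by (rule M.a_repr_independence[OF _ smult_closed[OF r x] S.a_subgroup, symmetric])
  qed
  moreover have "x \<in> H +>\<^bsub>M\<^esub> x" using S.a_rcos_self x by simp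
  ultimately have "(\<Union>y\<in>H +>\<^bsub>M\<^esub> x. H +>\<^bsub>M\<^esub> (r \<odot>\<^bsub>M\<^esub> y)) = H +>\<^bsub>M\<^esub> (r \<odot>\<^bsub>M\<^esub> x)"
    by (intro UN_constant_eq) blast+
  then show ?thesis by (simp add: quotient_module_def)
qed

lemma (in module) quotient_module:
  assumes H: "LinearCombinations.submodule R H M"
  shows "module R (quotient_module M H)"
proof -
  interpret H: LinearCombinations.submodule R H M by (rule H)
  interpret S: abelian_subgroup H M by (rule submodule_abelian_subgroup[OF H])
  let ?Q = "quotient_module M H"
  have car: "C \<in> carrier ?Q \<longleftrightarrow> (\<exists>x\<in>carrier M. C = H +>\<^bsub>M\<^esub> x)" for C
    by (auto simp: quotient_module_def A_RCOSETS_def')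
  have add: "(H +>\<^bsub>M\<^esub> x) \<oplus>\<^bsub>?Q\<^esub> (H +>\<^bsub>M\<^esub> y) = H +>\<^bsub>M\<^esub> (x \<oplus>\<^bsub>M\<^esub> y)"
    if "x \<in> carrier M" "y \<in> carrier M" for x y
    using S.a_rcos_sum[OF that] by (simp add: quotient_module_def)
  have zero: "\<zero>\<^bsub>?Q\<^esub> = H +>\<^bsub>M\<^esub> \<zero>\<^bsub>M\<^esub>"
    using M.a_coset_add_zero[OF H.subset] by (simp add: quotient_module_def)
  note smult = smult_coset[OF H]
  have "abelian_group ?Q"
  proof (rule abelian_groupI)
    fix C assume "C \<in> carrier ?Q"
    then obtain x where x: "x \<in> carrier M" "C = H +>\<^bsub>M\<^esub> x" by (auto simp: car)
    show "\<exists>D\<in>carrier ?Q. D \<oplus>\<^bsub>?Q\<^esub> C = \<zero>\<^bsub>?Q\<^esub>"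
      by (rule bexI[where x = "H +>\<^bsub>M\<^esub> (\<ominus>\<^bsub>M\<^esub> x)"])
         (use x in \<open>auto simp: add zero car M.l_neg\<close>)
  next
    show "C \<oplus>\<^bsub>?Q\<^esub> D = D \<oplus>\<^bsub>?Q\<^esub> C" if "C \<in> carrier ?Q" "D \<in> carrier ?Q" for C D
      using that by (auto simp only: car add M.a_comm)
  qed (auto simp: car add zero M.a_assoc
            intro: bexI[OF refl M.add.m_closed] bexI[OF refl M.zero_closed])
  then show ?thesis
    by (intro moduleI is_cring)
       (auto simp: car add smult smult_l_distr smult_r_distr smult_assoc1
             intro: bexI[OF refl smult_closed])
qed

context cring
begin

lemma lcs_module: "module R ((free_alg R n k)\<lparr>carrier := lcs R n k i\<rparr>)"
  using module.submodule_is_module[OF free_alg_module lcs_submodule] .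

lemma lcs_Suc_submodule:
  "LinearCombinations.submodule R (lcs R n k (Suc i)) ((free_alg R n k)\<lparr>carrier := lcs R n k i\<rparr>)"
proof -
  interpret S: LinearCombinations.submodule R "lcs R n k (Suc i)" "free_alg R n k"
    by (rule lcs_submodule)
  show ?thesis
  proof (rule LinearCombinations.submodule.intro)
    show "module R ((free_alg R n k)\<lparr>carrier := lcs R n k i\<rparr>)" by (rule lcs_module)
    show "lcs R n k (Suc i) \<subseteq> carrier ((free_alg R n k)\<lparr>carrier := lcs R n k i\<rparr>)"
      using lcs_Suc_subset by (simp del: lcs.simps)
  qed (use S.m_closed S.zero_closed S.smult_closed in
        \<open>simp_all del: free_alg_simps lcs.simps S.m_closed S.zero_closed S.smult_closed\<close>)
qed

lemma Bquot_module: "module R (Bquot R n k i)"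
  unfolding Bquot_def by (rule module.quotient_module[OF lcs_module lcs_Suc_submodule])

lemma homog_submodule: "LinearCombinations.submodule R (homog R n k m) (free_alg R n k)"
proof (rule LinearCombinations.submodule.intro)
  have s: "supp R (\<lambda>w. a w \<oplus> b w) \<subseteq> supp R a \<union> supp R b" for a b
    by (auto simp: supp_def)
  have t: "supp R (\<lambda>w. r \<otimes> a w) \<subseteq> supp R a" if "r \<in> carrier R" for r a
    using that by (auto simp: supp_def)
  show "v \<oplus>\<^bsub>free_alg R n k\<^esub> w \<in> homog R n k m"
    if "v \<in> homog R n k m" "w \<in> homog R n k m" for v w
    using that s[of v w] free_alg_add_closed[of v n k w] by (auto simp: homog_def)
  show "c \<odot>\<^bsub>free_alg R n k\<^esub> v \<in> homog R n k m"
    if "c \<in> carrier R" "v \<in> homog R n k m" for c v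
    using that t[of c v] free_alg_smult_closed[of c v n k] by (auto simp: homog_def)
  show "\<zero>\<^bsub>free_alg R n k\<^esub> \<in> homog R n k m"
    by (auto simp: homog_def free_alg_carrier supp_def)
qed (auto simp: homog_def free_alg_module)

lemma Bquot_comp_module: "module R (Bquot_comp R n k i m)"
proof -
  let ?A = "free_alg R n k" and ?H = "lcs R n k (Suc i)"
  let ?L = "?A\<lparr>carrier := lcs R n k i\<rparr>"
  interpret L: module R ?L by (rule lcs_module)
  interpret Bm: module R "Bquot R n k i" by (rule Bquot_module)
  interpret S: abelian_subgroup ?H ?L
    by (rule L.submodule_abelian_subgroup[OF lcs_Suc_submodule])
  interpret P: LinearCombinations.submodule R "lcs R n k i" ?A by (rule lcs_submodule)
  interpret G: LinearCombinations.submodule R "homog R n k m" ?A by (rule homog_submodule)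
  let ?C = "(\<lambda>a. ?H +>\<^bsub>?A\<^esub> a) ` (lcs R n k i \<inter> homog R n k m)"
  have coset: "?H +>\<^bsub>?A\<^esub> a = ?H +>\<^bsub>?L\<^esub> a" for a
    by (simp add: a_r_coset_def')
  have car: "carrier (Bquot R n k i) = (\<lambda>a. ?H +>\<^bsub>?A\<^esub> a) ` lcs R n k i"
    by (auto simp: Bquot_def quotient_module_def A_RCOSETS_def' coset)
  have add: "(?H +>\<^bsub>?A\<^esub> a) \<oplus>\<^bsub>Bquot R n k i\<^esub> (?H +>\<^bsub>?A\<^esub> b) = ?H +>\<^bsub>?A\<^esub> (a \<oplus>\<^bsub>?A\<^esub> b)"
    if "a \<in> lcs R n k i" "b \<in> lcs R n k i" for a b
    using S.a_rcos_sum[of a b] that by (simp add: Bquot_def quotient_module_def coset)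
  have smult: "r \<odot>\<^bsub>Bquot R n k i\<^esub> (?H +>\<^bsub>?A\<^esub> a) = ?H +>\<^bsub>?A\<^esub> (r \<odot>\<^bsub>?A\<^esub> a)"
    if "r \<in> carrier R" "a \<in> lcs R n k i" for r a
    using L.smult_coset[OF lcs_Suc_submodule that(1), of a] that(2) by (simp add: Bquot_def coset)
  have zero: "\<zero>\<^bsub>Bquot R n k i\<^esub> = ?H +>\<^bsub>?A\<^esub> \<zero>\<^bsub>?A\<^esub>"
    using L.M.a_coset_add_zero[OF S.a_subset] by (simp add: Bquot_def quotient_module_def coset)
  have "LinearCombinations.submodule R ?C (Bquot R n k i)"
  proof (rule LinearCombinations.submodule.intro)
    show "?C \<subseteq> carrier (Bquot R n k i)" by (auto simp: car)
    show "v \<oplus>\<^bsub>Bquot R n k i\<^esub> w \<in> ?C" if vw: "v \<in> ?C" "w \<in> ?C" for v w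
    proof -
      from vw obtain a b where
        a: "a \<in> lcs R n k i" "a \<in> homog R n k m" "v = ?H +>\<^bsub>?A\<^esub> a" and
        b: "b \<in> lcs R n k i" "b \<in> homog R n k m" "w = ?H +>\<^bsub>?A\<^esub> b" by blast
      have "v \<oplus>\<^bsub>Bquot R n k i\<^esub> w = ?H +>\<^bsub>?A\<^esub> (a \<oplus>\<^bsub>?A\<^esub> b)"
        unfolding a(3) b(3) by (rule add) fact+
      moreover have "a \<oplus>\<^bsub>?A\<^esub> b \<in> lcs R n k i \<inter> homog R n k m"
        using a b P.m_closed G.m_closed by blast
      ultimately show ?thesis by (rule image_eqI)
    qed
    show "c \<odot>\<^bsub>Bquot R n k i\<^esub> v \<in> ?C" if c: "c \<in> carrier R" and v: "v \<in> ?C" for c v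
    proof -
      from v obtain a where
        a: "a \<in> lcs R n k i" "a \<in> homog R n k m" "v = ?H +>\<^bsub>?A\<^esub> a" by blast
      have "c \<odot>\<^bsub>Bquot R n k i\<^esub> v = ?H +>\<^bsub>?A\<^esub> (c \<odot>\<^bsub>?A\<^esub> a)"
        unfolding a(3) by (rule smult) fact+
      moreover have "c \<odot>\<^bsub>?A\<^esub> a \<in> lcs R n k i \<inter> homog R n k m"
        using a c P.smult_closed G.smult_closed by blast
      ultimately show ?thesis by (rule image_eqI)
    qed
    show "\<zero>\<^bsub>Bquot R n k i\<^esub> \<in> ?C"
      unfolding zero using P.zero_closed G.zero_closed by blast
  qed (rule Bquot_module)
  then show ?thesis
    unfolding Bquot_comp_def by (rule Bm.submodule_is_module)
qed

declare free_alg_simps [simp del]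

end

lemma Bquot_comp_vectorspace:
  assumes "prime p"
  shows "vectorspace (residue_ring (int p)) (Bquot_comp (residue_ring (int p)) n k i m)"
proof -
  interpret residues_prime p "residue_ring (int p)"
    by (unfold_locales) (use assms in auto)
  show ?thesis
    by (intro vectorspace.intro Bquot_comp_module is_field)
qed

end

theory Submission
  imports Defs "HOL-Library.Poly_Mapping"
begin

text \<open>
  Let \<open>A\<close> be the free superalgebra over the integers on the given generators \<open>x g\<close>, let \<open>L i\<close> be
  its lower central series and let \<open>M N = A L N\<close>, a two-sided ideal. The bound comes from
  three observations, all of them valid over the integers, so that no prime is ever exceptional.

  \<^item> The identity \<open>[ab, c] = [a, bc] \<plusminus> [b, ca]\<close> lets one peel letters off the first argument, so
    \<open>L 2\<close> is the sum of the groups \<open>[x g, A]\<close> over the generators (\<open>br_mon_in_span_generators\<close>).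
  \<^item> For every \<open>i\<close> there is an \<open>N\<close> with \<open>[A, M N] \<subseteq> L (i + 1)\<close> (\<open>br_M_D\<close>). Hence
    \<open>w \<mapsto> [x g, w]\<close> induces a surjection from a finite power of \<open>A / M N\<close> onto \<open>L 2 / L (i + 1)\<close>, a
    group that contains \<open>B i\<close> when \<open>i \<ge> 2\<close>. This surjection shifts multidegrees by one letter, so it
    is enough to bound the multidegree components of \<open>A / M N\<close>.
  \<^item> There is a finite set \<open>C\<close> of homogeneous elements such that the products of a sorted monomial
    with an element of \<open>C\<close> span \<open>A\<close> modulo \<open>M N\<close> (\<open>finitely_generated_mod_M\<close>). In a given
    multidegree the sorted monomial is determined by the element of \<open>C\<close>, so at most \<open>card C\<close> of
    these products occur.

  For the third point, supercommutators of generators \<open>z g h = [x g, x h]\<close> are central modulo \<open>M 3\<close>,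
  and \<open>z g h * z g h\<close> equals \<open>z h h * z g g\<close> there. This equation replaces the nilpotency
  \<open>z g h * z g h = 0\<close> known for even generators: for odd ones the right-hand side is
  four times a product of squares of generators, which can be moved into the monomial.
  So modulo the ideal generated by these finitely many relations
  \<open>A\<close> is spanned by the sorted monomials times products of distinct \<open>z g h\<close> (\<open>mon_in_normal_span\<close>). The
  relations lie in \<open>M 3\<close>, and \<open>M 3 M j \<subseteq> M (j + 1)\<close> (\<open>M2_mult_M\<close>), so a product of \<open>N\<close> of them
  lies in \<open>M N\<close>; substituting the spanning statement into itself \<open>N\<close> times therefore leaves nothing
  but finitely many layers of products.

  The last step reduces the integral statement modulo \<open>p\<close>: the bound \<open>K\<close> was found before any prime was
  chosen, and the component of \<open>B i\<close> over the field with \<open>p\<close> elements is contained in the span of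
  the images of the integral spanning set (\<open>Bquot_dim_le\<close>).

  In the formal text the series starts at 0: \<open>D i\<close> is \<open>L (i + 1)\<close> and \<open>M t\<close> is the ideal generated by \<open>D t\<close>.
\<close>

section \<open>Additive spans\<close>

inductive_set add_span :: "'a::ab_group_add set \<Rightarrow> 'a set" for S where
  base: "x \<in> S \<Longrightarrow> x \<in> add_span S"
| zero: "0 \<in> add_span S"
| diff: "x \<in> add_span S \<Longrightarrow> y \<in> add_span S \<Longrightarrow> x - y \<in> add_span S"

definition add_subgroup :: "'a::ab_group_add set \<Rightarrow> bool" where
  "add_subgroup S \<longleftrightarrow> 0 \<in> S \<and> (\<forall>x\<in>S. \<forall>y\<in>S. x - y \<in> S)"

lemma add_subgroup_zero: "add_subgroup S \<Longrightarrow> 0 \<in> S"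
  and add_subgroup_diff: "add_subgroup S \<Longrightarrow> x \<in> S \<Longrightarrow> y \<in> S \<Longrightarrow> x - y \<in> S"
  by (auto simp: add_subgroup_def)

lemma add_subgroup_uminus: "add_subgroup S \<Longrightarrow> x \<in> S \<Longrightarrow> - x \<in> S"
  using add_subgroup_diff[of S 0 x] add_subgroup_zero by auto

lemma add_subgroup_add: "add_subgroup S \<Longrightarrow> x \<in> S \<Longrightarrow> y \<in> S \<Longrightarrow> x + y \<in> S"
  using add_subgroup_diff[of S x "- y"] add_subgroup_uminus[of S y] by simp

lemma add_subgroup_UNIV [simp]: "add_subgroup UNIV"
  by (simp add: add_subgroup_def)

lemma add_subgroup_add_span [simp]: "add_subgroup (add_span S)"
  by (auto simp: add_subgroup_def intro: add_span.intros)

text \<open>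
  An additive map sends a span into a subgroup as soon as it sends the generators there. Nearly
  every inclusion below is proved by this rule, with an explicit identity on the generators.
\<close>

lemma add_span_map:
  assumes "x \<in> add_span S" and "\<And>s. s \<in> S \<Longrightarrow> f s \<in> T" and "add_subgroup T"
    and "\<And>x y. f (x - y) = f x - f y"
  shows "f x \<in> T"
proof -
  have "f (0 - 0) = f 0 - f 0" by (rule assms(4))
  then have "f 0 = 0" by simp
  from assms(1) show ?thesis
    by induction (simp_all add: \<open>f 0 = 0\<close> assms(2,4) add_subgroup_zero add_subgroup_diff assms(3))
qed

lemma add_span_least: "x \<in> add_span S \<Longrightarrow> S \<subseteq> T \<Longrightarrow> add_subgroup T \<Longrightarrow> x \<in> T"
  using add_span_map[where f = "\<lambda>x. x"] by blast

lemma add_span_mono: "x \<in> add_span S \<Longrightarrow> S \<subseteq> T \<Longrightarrow> x \<in> add_span T"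
  by (erule add_span_least) (auto intro: add_span.base)

section \<open>Superrings and their lower central series\<close>

text \<open>
  A \<open>\<int>/2\<close>-grading is given by its projection \<open>od\<close> onto the odd part; the even part of \<open>x\<close> is
  \<open>x - od x\<close>. The sign automorphism \<open>x \<mapsto> x - 2 od x\<close> would determine \<open>od\<close> only up to 2-torsion.
\<close>

locale super_ring =
  fixes od :: "'a::ring_1 \<Rightarrow> 'a"
  assumes od_add [simp]: "od (x + y) = od x + od y"
    and od_od [simp]: "od (od x) = od x"
    and od_mult: "od (x * y) = od x * (y - od y) + (x - od x) * od y"
begin

lemma od_0 [simp]: "od 0 = 0"
  using od_add[of 0 0] by simp

lemma od_uminus [simp]: "od (- x) = - od x"
  using od_add[of x "- x"] by (simp add: add_eq_0_iff)

lemma od_diff [simp]: "od (x - y) = od x - od y"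
  using od_add[of x "- y"] by simp

lemma od_1 [simp]: "od 1 = 0"
proof -
  have *: "od 1 = od 1 * od 1 + od 1 * od 1"
    using od_mult[of 1 1] by (simp add: algebra_simps)
  have "od (od 1 * od 1) = 0" by (simp add: od_mult)
  then have "od (od 1) = 0" by (subst *) simp
  then show ?thesis by simp
qed

text \<open>
  On homogeneous arguments this is \<open>x y \<plusminus> y x\<close>: the correction \<open>2 od y od x\<close> turns the minus sign into
  a plus sign exactly when both arguments are odd. Because the formula is additive in each argument,
  the signed identities below hold for arbitrary elements, the sign being replaced by a multiple of a
  term in the odd parts.
\<close>

definition br :: "'a \<Rightarrow> 'a \<Rightarrow> 'a" where
  "br x y = x * y - y * x + od y * od x + od y * od x"

lemma br_add_left [simp]: "br (x + y) z = br x z + br y z"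
  and br_diff_left [simp]: "br (x - y) z = br x z - br y z"
  and br_add_right [simp]: "br z (x + y) = br z x + br z y"
  and br_diff_right [simp]: "br z (x - y) = br z x - br z y"
  by (simp_all add: br_def algebra_simps)

lemma br_0 [simp]: "br 0 x = 0" "br x 0 = 0"
  by (simp_all add: br_def)

lemma od_br: "od (br x y) = br (od x) (y - od y) + br (x - od x) (od y)"
  by (simp add: br_def od_mult algebra_simps)

lemma br_antisym: "br x y = - br y x + br (od y) (od x) + br (od y) (od x)"
  by (simp add: br_def algebra_simps)

lemma br_jacobi: "br (br x y) z = br x (br y z) - br y (br x z) + br (od y) (br (od x) z) + br (od y) (br (od x) z)"
  by (simp add: br_def od_mult algebra_simps)

text \<open>
  The signed form of \<open>[xy, z] = [x, yz] + [y, zx]\<close>. In every term the first argument is \<open>x\<close>, \<open>y\<close> or a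
  part of \<open>y\<close>, so the product \<open>xy\<close> of two elements of \<open>D i\<close> brackets the whole ring into \<open>D (i + 1)\<close>.
\<close>

lemma br_cyclic: "br (x * y) z = br x (y * z) + br y (z * x)
   - (br (y - od y) (od z * od x) + br (od y) ((z - od z) * od x))
   - (br (y - od y) (od z * od x) + br (od y) ((z - od z) * od x))"
  by (simp add: br_def od_mult algebra_simps)

text \<open>
  The Leibniz rule solved for \<open>x [b, l]\<close>: modulo brackets, a product of \<open>x\<close> with a commutator
  trades one level of \<open>[b, l]\<close> for one level of \<open>[b, x]\<close>.
\<close>

lemma mult_br_right: "x * br b l = br b (x * l) - br b x * l + br (od b) (od x) * l + br (od b) (od x) * l
    - br (od b) (od x * l) - br (od b) (od x * l)"
  by (simp add: br_def od_mult algebra_simps)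

primrec D :: "nat \<Rightarrow> 'a set" where
  "D 0 = UNIV"
| "D (Suc i) = add_span {br a b | a b. b \<in> D i}"

lemma add_subgroup_D [simp]: "add_subgroup (D i)"
  by (cases i) auto

lemma br_in_D: "b \<in> D i \<Longrightarrow> br a b \<in> D (Suc i)"
  by (auto intro: add_span.base)

lemma D_Suc_induct:
  assumes "x \<in> D (Suc i)" and "\<And>a b. b \<in> D i \<Longrightarrow> f (br a b) \<in> T" and "add_subgroup T"
    and "\<And>x y. f (x - y) = f x - f y"
  shows "f x \<in> T"
  using assms(1) unfolding D.simps by (rule add_span_map) (use assms in auto)

lemma od_D: "x \<in> D i \<Longrightarrow> od x \<in> D i"
proof (induction i arbitrary: x)
  case (Suc i)
  show ?case
    by (rule D_Suc_induct[where f = od, OF Suc.prems])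
       (auto simp: od_br simp del: D.simps intro!: add_subgroup_add br_in_D Suc.IH add_subgroup_diff)
qed simp

lemma D_Suc_subset: "x \<in> D (Suc i) \<Longrightarrow> x \<in> D i"
proof (induction i arbitrary: x)
  case (Suc i)
  show ?case
    by (rule D_Suc_induct[where f = "\<lambda>x. x", OF Suc.prems]) (auto intro: br_in_D Suc.IH simp del: D.simps)
qed simp

lemma D_antimono: "i \<le> j \<Longrightarrow> x \<in> D j \<Longrightarrow> x \<in> D i"
  by (induction j) (auto simp: le_Suc_eq simp del: D.simps(2) dest: D_Suc_subset)

lemma br_in_D_left: "b \<in> D i \<Longrightarrow> br b a \<in> D (Suc i)"
  by (subst br_antisym) (intro add_subgroup_add add_subgroup_uminus add_subgroup_D br_in_D od_D)

lemma br_D1: assumes "u \<in> D 1" "l \<in> D i" shows "br u l \<in> D (Suc (Suc i))"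
  using assms(1) unfolding One_nat_def
proof (rule D_Suc_induct[where f = "\<lambda>u. br u l"])
  show "br (br a b) l \<in> D (Suc (Suc i))" for a b
    unfolding br_jacobi
    by (intro add_subgroup_add add_subgroup_diff add_subgroup_D br_in_D assms)
qed simp_all

text \<open>
  \<open>P j t\<close> is the additive span of the products \<open>D j D t\<close>. The case \<open>j = 0\<close> is the left ideal generated by
  \<open>D t\<close>; it is two-sided since \<open>y a\<close> and \<open>a y\<close> differ by a bracket, up to sign.
\<close>

definition P :: "nat \<Rightarrow> nat \<Rightarrow> 'a set" where
  "P j t = add_span {x * y | x y. x \<in> D j \<and> y \<in> D t}"

abbreviation M :: "nat \<Rightarrow> 'a set" where "M t \<equiv> P 0 t"

lemma add_subgroup_P [simp]: "add_subgroup (P j t)"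
  by (simp add: P_def)

lemma mult_in_P: "x \<in> D j \<Longrightarrow> y \<in> D t \<Longrightarrow> x * y \<in> P j t"
  by (auto simp: P_def intro: add_span.base)

lemma P_induct:
  assumes "x \<in> P j t" and "\<And>a b. a \<in> D j \<Longrightarrow> b \<in> D t \<Longrightarrow> f (a * b) \<in> T" and "add_subgroup T"
    and "\<And>x y. f (x - y) = f x - f y"
  shows "f x \<in> T"
  using assms(1) unfolding P_def by (rule add_span_map) (use assms in auto)

lemma D_subset_M: "x \<in> D t \<Longrightarrow> x \<in> M t"
  using mult_in_P[of 1 0 x t] by simp

lemma M_mult_left: assumes "x \<in> M t" shows "a * x \<in> M t"
proof (rule P_induct[where f = "\<lambda>x. a * x", OF assms])
  show "a * (b * y) \<in> M t" if "b \<in> D 0" "y \<in> D t" for b y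
    unfolding mult.assoc[symmetric] by (rule mult_in_P) (simp_all add: that)
qed (simp_all add: right_diff_distrib)

lemma M_mult_right: assumes "x \<in> M t" shows "x * a \<in> M t"
proof (rule P_induct[where f = "\<lambda>x. x * a", OF assms])
  fix b y assume y: "y \<in> D t"
  have "b * y * a = b * (a * y + br y a - od a * od y - od a * od y)"
    by (simp add: br_def algebra_simps)
  also have "\<dots> \<in> M t"
    by (intro M_mult_left add_subgroup_diff add_subgroup_add add_subgroup_P D_subset_M y od_D
          D_Suc_subset[OF br_in_D_left])
  finally show "b * y * a \<in> M t" .
qed (simp_all add: left_diff_distrib)

lemma od_M: assumes "x \<in> M t" shows "od x \<in> M t"
proof (rule P_induct[where f = od, OF assms])
  fix a b assume "a \<in> D 0" "b \<in> D t"
  then show "od (a * b) \<in> M t"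
    unfolding od_mult by (intro add_subgroup_add add_subgroup_diff add_subgroup_P add_subgroup_D mult_in_P od_D)
qed simp_all

lemma br_M: "x \<in> M t \<Longrightarrow> br a x \<in> M t"
  unfolding br_def by (intro add_subgroup_add add_subgroup_diff add_subgroup_P M_mult_left M_mult_right od_M)

lemma M_antimono: assumes "i \<le> j" "x \<in> M j" shows "x \<in> M i"
proof (rule P_induct[where f = "\<lambda>x. x", OF assms(2)])
  show "a * b \<in> M i" if "a \<in> D 0" "b \<in> D j" for a b
    by (intro mult_in_P that D_antimono[OF assms(1)])
qed simp_all

text \<open>
  Bracket the Leibniz expansion of \<open>[u d, l]\<close> with \<open>a\<close>. The left-hand side \<open>[a, [u d, l]]\<close> and the terms with
  \<open>[a, [d, l]]\<close> lie deep enough, and since \<open>u\<close> is itself a commutator, so do the terms with \<open>[u, l]\<close>,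
  which gain two levels. What remains is the product \<open>[a, u] [d, l]\<close>.
\<close>

lemma D2_mult_D:
  assumes "x \<in> D 2" "y \<in> D (Suc t)"
  shows "x * y \<in> M (Suc (Suc t))"
proof -
  have main: "br a u * br d l \<in> M (Suc (Suc t))" if u: "u \<in> D 1" and l: "l \<in> D t" for a u d l
  proof -
    have p: "br u l' \<in> M (Suc (Suc t))" if "l' \<in> D t" for l'
      using D_subset_M br_D1 u that by blast
    have "br a u * br d l = br a (br (u * d) l) - u * br a (br d l)
        + od u * br (od a) (br d l) + od u * br (od a) (br d l)
        - br a (br u l * d) + br a (br u (od l) * od d) + br a (br u (od l) * od d)"
      by (simp add: br_def od_mult algebra_simps)
    also have "\<dots> \<in> M (Suc (Suc t))"
    proof -
      have q: "br b (br c l) \<in> M (Suc (Suc t))" for b c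
        by (intro D_subset_M br_in_D l)
      have r: "br b (br u l' * c) \<in> M (Suc (Suc t))" if "l' \<in> D t" for b c l'
        by (intro br_M M_mult_right p that)
      show ?thesis
        by (intro add_subgroup_add add_subgroup_diff add_subgroup_P q r M_mult_left od_D l)
    qed
    finally show ?thesis .
  qed
  show ?thesis
    using assms(1) unfolding numeral_2_eq_2
  proof (rule D_Suc_induct[where f = "\<lambda>x. x * y"])
    fix a u assume u: "u \<in> D (Suc 0)"
    show "br a u * y \<in> M (Suc (Suc t))"
      by (rule D_Suc_induct[where f = "\<lambda>y. br a u * y", OF assms(2)]) (use u in \<open>auto intro: main simp: algebra_simps simp del: D.simps\<close>)
  qed (auto simp: algebra_simps)
qed

lemma M2_mult_M:
  assumes "x \<in> M 2" "y \<in> M (Suc t)"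
  shows "x * y \<in> M (Suc (Suc t))"
proof (rule P_induct[where f = "\<lambda>x. x * y", OF assms(1)])
  fix a b assume b: "b \<in> D 2"
  have "b * y \<in> M (Suc (Suc t))"
  proof (rule P_induct[where f = "\<lambda>y. b * y", OF assms(2)])
    fix c d assume d: "d \<in> D (Suc t)"
    have "b * c \<in> M 2" using D_subset_M M_mult_right b by blast
    then have "b * c * d \<in> M (Suc (Suc t))"
      by (rule P_induct[where f = "\<lambda>x. x * d"])
         (auto simp: left_diff_distrib mult.assoc intro: M_mult_left D2_mult_D d)
    then show "b * (c * d) \<in> M (Suc (Suc t))" by (simp add: mult.assoc)
  qed (auto simp: algebra_simps)
  then show "a * b * y \<in> M (Suc (Suc t))" by (simp add: mult.assoc M_mult_left)
qed (auto simp: algebra_simps)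

text \<open>
  Induction on \<open>r\<close>, and for given \<open>r\<close> on how far \<open>j\<close> falls short of \<open>r\<close>; the right factor is kept deep, so that only
  the left one has to grow. When both factors are deep the cyclic identity applies. Otherwise one level is moved from the right factor to the left one by
  \<open>mult_br_right\<close>; the error terms are brackets of products whose total depth has dropped by one, which
  the induction on \<open>r\<close> compensates with the additional bracket.
\<close>

lemma br_P:
  assumes "t \<ge> r" "j + t \<ge> 2 * r" "x \<in> P j t"
  shows "br e x \<in> D (Suc r)"
  using assms
proof (induction r arbitrary: j t e x)
  case 0
  then show ?case by (intro br_in_D) simp
next
  case (Suc r)
  note outer = Suc.IH
  have cyc: "br e (a * b) \<in> D (Suc (Suc r))" if ab: "a \<in> D (Suc r)" "b \<in> D (Suc r)" for e a b
  proof -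
    have *: "br (a * b) e \<in> D (Suc (Suc r))" if "a \<in> D (Suc r)" "b \<in> D (Suc r)" for e a b
      unfolding br_cyclic
      by (intro add_subgroup_add add_subgroup_diff add_subgroup_D br_in_D_left that od_D)
    have "br (od (a * b)) e' \<in> D (Suc (Suc r))" for e'
      unfolding od_mult br_add_left by (intro add_subgroup_add add_subgroup_diff add_subgroup_D * od_D ab)
    then show ?thesis
      by (subst br_antisym) (intro add_subgroup_add add_subgroup_uminus add_subgroup_D * ab)
  qed
  from Suc.prems show ?case
  proof (induction "Suc r - j" arbitrary: j t e x)
    case 0
    show ?case
      by (rule P_induct[where f = "br e", OF "0.prems"(3)])
         (use 0 in \<open>auto intro!: cyc intro: D_antimono[of _ j] D_antimono[of _ t] simp del: D.simps\<close>)
  next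
    case (Suc k)
    from Suc.hyps(2) Suc.prems(2) obtain t' where t': "t = Suc t'" by (cases t) auto
    show ?case
    proof (rule P_induct[where f = "br e", OF Suc.prems(3)])
      fix a y assume a: "a \<in> D j" and y: "y \<in> D t"
      have 1: "br e (br b (c * l)) \<in> D (Suc (Suc r))" if "c \<in> D j" "l \<in> D t'" for b c l
        by (intro br_in_D outer[of t' j])
           (use Suc.prems Suc.hyps(2) t' that in \<open>auto intro: mult_in_P\<close>)
      have 2: "br e (br b c * l) \<in> D (Suc (Suc r))" if "c \<in> D j" "l \<in> D t'" for b c l
        by (rule Suc.hyps(1)[of "Suc j" t'])
           (use Suc.prems Suc.hyps(2) t' that br_in_D in \<open>auto intro: mult_in_P simp del: D.simps\<close>)
      show "br e (a * y) \<in> D (Suc (Suc r))"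
      proof (rule D_Suc_induct[where f = "\<lambda>y. br e (a * y)", OF y[unfolded t']])
        fix b l assume l: "l \<in> D t'"
        show "br e (a * br b l) \<in> D (Suc (Suc r))"
          unfolding mult_br_right br_add_right br_diff_right
          by (intro add_subgroup_add add_subgroup_diff add_subgroup_D 1 2 od_D a l)
      qed (auto simp: right_diff_distrib)
    qed (auto)
  qed
qed

lemma br_M_D: "x \<in> M (2 * r) \<Longrightarrow> br e x \<in> D (Suc r)"
  by (rule br_P[of r "2 * r" 0]) auto

section \<open>Homogeneous elements, monomials and their commutators\<close>

text \<open>Homogeneous with respect to parity only; multidegrees are tracked separately as multisets.\<close>

definition homogeneous :: "'a \<Rightarrow> bool" where
  "homogeneous a \<longleftrightarrow> od a = a \<or> od a = 0"

lemma hom_mult: "homogeneous a \<Longrightarrow> homogeneous b \<Longrightarrow> homogeneous (a * b)"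
  by (auto simp: homogeneous_def od_mult)

lemma hom_br: "homogeneous a \<Longrightarrow> homogeneous b \<Longrightarrow> homogeneous (br a b)"
  by (auto simp: homogeneous_def od_br)

lemma hom_br_cases: "homogeneous a \<Longrightarrow> homogeneous b \<Longrightarrow> br a b = a * b - b * a \<or> br a b = a * b + b * a"
  by (auto simp: homogeneous_def br_def)

lemma hom_br_swap: "homogeneous a \<Longrightarrow> homogeneous b \<Longrightarrow> br a b = br b a \<or> br a b = - br b a"
  by (auto simp: homogeneous_def br_def)

lemma br_odd_square:
  assumes "homogeneous a" "od b = b"
  shows "br a (b * b) = br (br a b) b"
  using assms by (auto simp: homogeneous_def br_def od_mult algebra_simps)

lemma br_mult_left: "br (a * b) c = a * br b c + br a c * b - br a (od c) * od b - br a (od c) * od b"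
  by (simp add: br_def od_mult algebra_simps)

end

locale gen_super_ring = super_ring od
  for od :: "'a::ring_1 \<Rightarrow> 'a" +
  fixes x :: "'g::linorder \<Rightarrow> 'a" and par :: "'g \<Rightarrow> bool" and G :: "'g set"
  assumes finite_G: "finite G"
    and od_x: "od (x g) = (if par g then x g else 0)"
begin

definition mon :: "'g list \<Rightarrow> 'a" where
  "mon w = prod_list (map x w)"

lemma mon_simps [simp]: "mon [] = 1" "mon (g # w) = x g * mon w" "mon (v @ w) = mon v * mon w"
  by (simp_all add: mon_def)

definition z :: "'g \<Rightarrow> 'g \<Rightarrow> 'a" where
  "z g h = br (x g) (x h)"

definition zs :: "('g \<times> 'g) list \<Rightarrow> 'a" where
  "zs ps = prod_list (map (\<lambda>(g, h). z g h) ps)"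

lemma zs_simps [simp]: "zs [] = 1" "zs (p # ps) = z (fst p) (snd p) * zs ps" "zs (ps @ qs) = zs ps * zs qs"
  by (simp_all add: zs_def case_prod_beta)

definition zdeg :: "('g \<times> 'g) list \<Rightarrow> 'g multiset" where
  "zdeg ps = sum_list (map (\<lambda>(g, h). {#g, h#}) ps)"

lemma zdeg_simps [simp]: "zdeg [] = {#}" "zdeg (p # ps) = {#fst p, snd p#} + zdeg ps"
    "zdeg (ps @ qs) = zdeg ps + zdeg qs"
  by (simp_all add: zdeg_def case_prod_beta)

lemma hom_1: "homogeneous 1"
  by (simp add: homogeneous_def)

lemma hom_x: "homogeneous (x g)"
  by (simp add: homogeneous_def od_x)

lemma hom_mon: "homogeneous (mon w)"
  by (induction w) (simp_all add: hom_1 hom_mult hom_x)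

lemma hom_z: "homogeneous (z g h)"
  by (simp add: z_def hom_br hom_x)

lemma z_cases: "z g h = x g * x h - x h * x g \<or> z g h = x g * x h + x h * x g"
  unfolding z_def by (rule hom_br_cases[OF hom_x hom_x])

lemma hom_zs: "homogeneous (zs ps)"
  by (induction ps) (simp_all add: hom_1 hom_mult hom_z)

end

section \<open>Normal forms modulo a graded ideal\<close>

text \<open>
  Only the two families of relations and closure under multiplication by generators matter for the
  normal forms, so they are derived for any family of groups \<open>J\<close>, one for each multidegree, with these
  properties. Closure is required under the generators in \<open>G\<close> only, since the ring may contain others,
  for which \<open>J\<close> need not be an ideal.
\<close>

locale graded_ideal = gen_super_ring od x par G
  for od :: "'a::ring_1 \<Rightarrow> 'a" and x :: "'g::linorder \<Rightarrow> 'a" and par G +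
  fixes J :: "'g multiset \<Rightarrow> 'a set"
  assumes add_subgroup_J [simp]: "add_subgroup (J m)"
    and x_mult_J: "g \<in> G \<Longrightarrow> a \<in> J m \<Longrightarrow> x g * a \<in> J (add_mset g m)"
    and J_mult_x: "g \<in> G \<Longrightarrow> a \<in> J m \<Longrightarrow> a * x g \<in> J (add_mset g m)"
    and J_br: "f \<in> G \<Longrightarrow> g \<in> G \<Longrightarrow> h \<in> G \<Longrightarrow> br (x f) (z g h) \<in> J {#f, g, h#}"
    and J_sq: "g \<in> G \<Longrightarrow> h \<in> G \<Longrightarrow> z g h * z g h - z h h * z g g \<in> J {#g, g, h, h#}"
begin

text \<open>
  The elements that multiply \<open>J\<close> into itself while raising the multidegree by \<open>d\<close>. They
  contain the generators; products add up the degrees.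
\<close>

definition act :: "'g multiset \<Rightarrow> 'a set" where
  "act d = {b. \<forall>m. \<forall>a\<in>J m. b * a \<in> J (d + m) \<and> a * b \<in> J (d + m)}"

lemma act_left: "b \<in> act d \<Longrightarrow> a \<in> J m \<Longrightarrow> m' = d + m \<Longrightarrow> b * a \<in> J m'"
  and act_right: "b \<in> act d \<Longrightarrow> a \<in> J m \<Longrightarrow> m' = d + m \<Longrightarrow> a * b \<in> J m'"
  by (auto simp: act_def)

lemma add_subgroup_act: "add_subgroup (act d)"
  by (auto simp: add_subgroup_def act_def left_diff_distrib right_diff_distrib
      intro: add_subgroup_zero[OF add_subgroup_J] add_subgroup_diff[OF add_subgroup_J])

lemma act_mult: assumes "b \<in> act d" "c \<in> act e" shows "b * c \<in> act (d + e)"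
  unfolding act_def
proof (intro CollectI allI ballI conjI)
  fix m a assume a: "a \<in> J m"
  have "b * (c * a) \<in> J (d + e + m)"
    by (rule act_left[OF assms(1) act_left[OF assms(2) a refl]]) (simp add: ac_simps)
  then show "b * c * a \<in> J (d + e + m)" by (simp add: mult.assoc)
  have "(a * b) * c \<in> J (d + e + m)"
    by (rule act_right[OF assms(2) act_right[OF assms(1) a refl]]) (simp add: ac_simps)
  then show "a * (b * c) \<in> J (d + e + m)" by (simp add: mult.assoc)
qed

lemma x_act: "g \<in> G \<Longrightarrow> x g \<in> act {#g#}"
  by (auto simp: act_def x_mult_J J_mult_x)

lemma one_act: "1 \<in> act {#}"
  by (simp add: act_def)

lemma mon_act: "set w \<subseteq> G \<Longrightarrow> mon w \<in> act (mset w)"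
proof (induction w)
  case (Cons g w)
  then have "x g * mon w \<in> act ({#g#} + mset w)" by (intro act_mult x_act) auto
  then show ?case by simp
qed (simp add: one_act)

lemma z_act: assumes "g \<in> G" "h \<in> G" shows "z g h \<in> act {#g, h#}"
proof -
  have "x g * x h \<in> act ({#g#} + {#h#})" "x h * x g \<in> act ({#h#} + {#g#})"
    by (intro act_mult x_act assms)+
  then have "x g * x h \<in> act {#g, h#}" "x h * x g \<in> act {#g, h#}"
    by (simp_all add: add_mset_commute)
  then show ?thesis
    using z_cases[of g h] by (auto simp: add_subgroup_add add_subgroup_diff add_subgroup_act)
qed

lemma zs_act: "set ps \<subseteq> G \<times> G \<Longrightarrow> zs ps \<in> act (zdeg ps)"
proof (induction ps)
  case (Cons p ps)
  then have "z (fst p) (snd p) * zs ps \<in> act ({#fst p, snd p#} + zdeg ps)"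
    by (intro act_mult z_act) auto
  then show ?case by simp
qed (simp add: one_act)

lemma br_mult_in_J:
  assumes "br a q \<in> J (d + e)" "br b q \<in> J (d' + e)" "homogeneous q" "homogeneous b" "a \<in> act d" "b \<in> act d'"
  shows "br (a * b) q \<in> J (d + d' + e)"
proof -
  have "od b \<in> act d'" "br a (od q) \<in> J (d + e)"
    using assms add_subgroup_zero[OF add_subgroup_act] by (auto simp: homogeneous_def add_subgroup_zero)
  then show ?thesis unfolding br_mult_left
    by (intro add_subgroup_add add_subgroup_diff add_subgroup_J act_left[OF assms(5) assms(2)]
        act_right[OF assms(6) assms(1)] act_right[of "od b" d' "br a (od q)" "d + e"]) (simp_all add: ac_simps)
qed

lemma br_mon_in_J:
  assumes q: "\<And>f. f \<in> G \<Longrightarrow> br (x f) q \<in> J (add_mset f e)" "homogeneous q" and "set w \<subseteq> G"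
  shows "br (mon w) q \<in> J (mset w + e)"
  using assms(3)
proof (induction w)
  case Nil
  show ?case by (simp add: br_def add_subgroup_zero)
next
  case (Cons g w)
  then have "br (x g * mon w) q \<in> J ({#g#} + mset w + e)"
    by (intro br_mult_in_J x_act mon_act hom_mon q) (auto simp: q)
  then show ?case by simp
qed

lemma br_zs_in_J:
  assumes q: "\<And>f. f \<in> G \<Longrightarrow> br (x f) q \<in> J (add_mset f e)" "homogeneous q" and "set ps \<subseteq> G \<times> G"
  shows "br (zs ps) q \<in> J (zdeg ps + e)"
  using assms(3)
proof (induction ps)
  case Nil
  then show ?case using br_mon_in_J[OF q, of "[]"] by simp
next
  case (Cons p ps)
  define g h where "g = fst p" and "h = snd p"
  have gh: "g \<in> G" "h \<in> G" using Cons by (auto simp: g_def h_def)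
  have "br (z g h) q \<in> J ({#g, h#} + e)"
    using z_cases[of g h] br_mon_in_J[OF q, of "[g, h]"] br_mon_in_J[OF q, of "[h, g]"] gh
    by (auto simp: add_subgroup_add add_subgroup_diff add_mset_commute)
  then have "br (z g h * zs ps) q \<in> J ({#g, h#} + zdeg ps + e)"
    by (intro br_mult_in_J z_act zs_act hom_zs q gh) (use Cons in auto)
  then show ?case by (simp add: g_def h_def)
qed

definition congJ :: "'g multiset \<Rightarrow> 'a \<Rightarrow> 'a \<Rightarrow> bool" where
  "congJ m a b \<longleftrightarrow> a - b \<in> J m"

lemma congJ_refl [simp]: "congJ m a a"
  by (simp add: congJ_def add_subgroup_zero)

lemma congJ_sym: "congJ m a b \<Longrightarrow> congJ m b a"
  unfolding congJ_def using add_subgroup_uminus[OF add_subgroup_J, of "a - b" m] by simp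

lemma congJ_trans [trans]: "congJ m a b \<Longrightarrow> congJ m b c \<Longrightarrow> congJ m a c"
  unfolding congJ_def using add_subgroup_add[OF add_subgroup_J, of "a - b" m "b - c"] by simp

lemma congJ_uminus: "congJ m a b \<Longrightarrow> congJ m (- a) (- b)"
  unfolding congJ_def using add_subgroup_uminus[OF add_subgroup_J, of "a - b" m] by simp

lemma congJ_mult_left: "congJ m a b \<Longrightarrow> c \<in> act d \<Longrightarrow> m' = d + m \<Longrightarrow> congJ m' (c * a) (c * b)"
  unfolding congJ_def right_diff_distrib[symmetric] by (rule act_left)

lemma congJ_mult_right: "congJ m a b \<Longrightarrow> c \<in> act d \<Longrightarrow> m' = d + m \<Longrightarrow> congJ m' (a * c) (b * c)"
  unfolding congJ_def left_diff_distrib[symmetric] by (rule act_right)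

lemma congJ_swap:
  assumes "br a b \<in> J m" "homogeneous a" "homogeneous b"
  shows "congJ m (a * b) (b * a) \<or> congJ m (a * b) (- (b * a))"
  using hom_br_cases[OF assms(2,3)] assms(1) by (auto simp: congJ_def)

lemma br_swap_in_J: "br a b \<in> J m \<Longrightarrow> homogeneous a \<Longrightarrow> homogeneous b \<Longrightarrow> br b a \<in> J m"
  using hom_br_swap[of b a] by (auto simp: add_subgroup_uminus)

lemma z_central: "f \<in> G \<Longrightarrow> g \<in> G \<Longrightarrow> h \<in> G \<Longrightarrow> br (x f) (z g h) \<in> J (add_mset f {#g, h#})"
  using J_br[of f g h] by simp

text \<open>
  The square of an odd generator is central modulo \<open>J\<close> because \<open>[x f, x g x g] = [[x f, x g], x g]\<close>. Although
  \<open>z g g\<close> is twice this square, centrality of \<open>z g g\<close> would not give this over the integers.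
\<close>

lemma square_central:
  assumes "f \<in> G" "g \<in> G" "par g"
  shows "br (x f) (x g * x g) \<in> J (add_mset f {#g, g#})"
proof -
  have "br (x f) (x g * x g) = br (z f g) (x g)"
    unfolding z_def by (rule br_odd_square) (simp_all add: hom_x od_x assms(3))
  moreover have "br (z f g) (x g) \<in> J {#g, f, g#}"
    by (rule br_swap_in_J) (intro J_br hom_z hom_x assms)+
  moreover have "{#g, f, g#} = add_mset f {#g, g#}" by (rule add_mset_commute)
  ultimately show ?thesis by (simp only:)
qed

lemma square_commutes:
  assumes "par g" "g \<in> G" "set s \<subseteq> G" "set ps \<subseteq> G \<times> G" "m = mset s + zdeg ps + {#g, g#}"
  shows "congJ m (mon s * zs ps * (x g * x g)) (x g * x g * (mon s * zs ps))"
proof -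
  let ?q = "x g * x g"
  have q: "homogeneous ?q" by (simp add: hom_mult hom_x)
  have "br (mon s * zs ps) ?q \<in> J (mset s + zdeg ps + {#g, g#})"
    by (intro br_mult_in_J br_mon_in_J br_zs_in_J square_central q mon_act zs_act hom_zs assms)
  moreover have "od ?q = 0" using assms by (simp add: od_mult od_x)
  ultimately show ?thesis using assms(5) by (simp add: congJ_def br_def)
qed

text \<open>
  Inserting two equal odd letters into a sorted word creates no commutators. This is what makes the
  rewriting of a repeated factor \<open>z g h\<close> stop: its replacement is absorbed by the monomial.
\<close>

lemma insort_square:
  assumes "par g" "g \<in> G" "set s \<subseteq> G"
  shows "congJ (add_mset g (add_mset g (mset s))) (x g * x g * mon s) (mon (insort g (insort g s)))"
  using assms(3)
proof (induction s)
  case (Cons h t)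
  show ?case
  proof (cases "g \<le> h")
    case True
    then show ?thesis by (simp add: mult.assoc)
  next
    case False
    have h: "h \<in> G" "set t \<subseteq> G" using Cons.prems by auto
    have "congJ {#h, g, g#} (x h * (x g * x g)) (x g * x g * x h)"
      using square_commutes[OF assms(1,2), of "[h]" "[]" "{#h, g, g#}"] h by simp
    then have "congJ {#h, g, g#} (x g * x g * x h) (x h * (x g * x g))" by (rule congJ_sym)
    then have 1: "congJ (add_mset g (add_mset g (mset (h # t)))) (x g * x g * x h * mon t) (x h * (x g * x g) * mon t)"
      by (rule congJ_mult_right[OF _ mon_act]) (use h in auto)
    have 2: "congJ (add_mset g (add_mset g (mset (h # t)))) (x h * (x g * x g * mon t)) (x h * mon (insort g (insort g t)))"
      by (rule congJ_mult_left[OF Cons.IH x_act]) (use h in auto)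
    have "x h * (x g * x g) * mon t = x h * (x g * x g * mon t)" by (rule mult.assoc)
    then have "congJ (add_mset g (add_mset g (mset (h # t)))) (x g * x g * x h * mon t) (x h * mon (insort g (insort g t)))"
      using congJ_trans[OF 1] 2 by presburger
    then show ?thesis
      using False by (simp only: mon_simps insort_key.simps if_False mult.assoc)
  qed
qed simp

text \<open>
  Distinctness bounds the number of commutators that accompany a sorted monomial, uniformly in
  the multidegree.
\<close>

definition normal_forms :: "'g multiset \<Rightarrow> 'a set" where
  "normal_forms m = {mon s * zs ps | s ps. sorted s \<and> set s \<subseteq> G \<and> distinct ps \<and> set ps \<subseteq> G \<times> G \<and> mset s + zdeg ps = m}"

definition normal_span :: "'g multiset \<Rightarrow> 'a set" where
  "normal_span m = add_span (normal_forms m \<union> J m)"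

lemma add_subgroup_normal_span [simp]: "add_subgroup (normal_span m)"
  by (simp add: normal_span_def)

lemma J_in_normal_span: "a \<in> J m \<Longrightarrow> a \<in> normal_span m"
  by (auto simp: normal_span_def intro: add_span.base)

lemma normal_forms_in_normal_span:
  "sorted s \<Longrightarrow> set s \<subseteq> G \<Longrightarrow> distinct ps \<Longrightarrow> set ps \<subseteq> G \<times> G \<Longrightarrow> mset s + zdeg ps = m \<Longrightarrow> mon s * zs ps \<in> normal_span m"
  unfolding normal_span_def normal_forms_def by (rule add_span.base) blast

lemma congJ_in_add_span: "congJ m a b \<Longrightarrow> J m \<subseteq> S \<Longrightarrow> b \<in> add_span S \<Longrightarrow> a \<in> add_span S"
  using add_subgroup_add[OF add_subgroup_add_span add_span.base, of "a - b" S b] by (auto simp: congJ_def)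

lemma congJ_sign_in_add_span:
  assumes "congJ m a b \<or> congJ m a (- b)" "b \<in> add_span S" "J m \<subseteq> S"
  shows "a \<in> add_span S"
  using assms(1)
proof
  assume "congJ m a b"
  then show ?thesis by (rule congJ_in_add_span[OF _ assms(3,2)])
next
  assume "congJ m a (- b)"
  then show ?thesis by (rule congJ_in_add_span[OF _ assms(3) add_subgroup_uminus[OF add_subgroup_add_span assms(2)]])
qed

lemma congJ_in_normal_span: assumes "congJ m a b" "b \<in> normal_span m" shows "a \<in> normal_span m"
proof -
  have "(a - b) + b \<in> normal_span m"
    by (rule add_subgroup_add[OF add_subgroup_normal_span J_in_normal_span assms(2)]) (use assms(1) in \<open>simp add: congJ_def\<close>)
  then show ?thesis by simp
qed

lemma normal_span_induct:
  assumes "v \<in> normal_span m" and "\<And>a. a \<in> J m \<Longrightarrow> f a \<in> T"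
    and "\<And>s ps. sorted s \<Longrightarrow> set s \<subseteq> G \<Longrightarrow> distinct ps \<Longrightarrow> set ps \<subseteq> G \<times> G \<Longrightarrow> mset s + zdeg ps = m \<Longrightarrow> f (mon s * zs ps) \<in> T"
    and "add_subgroup T" and "\<And>x y. f (x - y) = f x - f y"
  shows "f v \<in> T"
  using assms(1) unfolding normal_span_def
proof (rule add_span_map[where f = f])
  show "f a \<in> T" if a: "a \<in> normal_forms m \<union> J m" for a
  proof (cases "a \<in> J m")
    case True
    then show ?thesis by (rule assms(2))
  next
    case False
    then obtain s ps where "a = mon s * zs ps" and s: "sorted s" "set s \<subseteq> G" "distinct ps"
      "set ps \<subseteq> G \<times> G" "mset s + zdeg ps = m"
      using a by (auto simp: normal_forms_def)
    then show ?thesis using assms(3)[OF s] by simp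
  qed
qed (fact assms)+

text \<open>
  If the new commutator already occurs, the two copies are brought together, where the relation
  turns their product into \<open>z h h * z g g\<close>. This vanishes unless both letters are odd, and then it is four
  times \<open>x h x h x g x g\<close>, which moves to the front and is inserted into the monomial.
\<close>

lemma normal_span_mult_z:
  assumes "v \<in> normal_span m" "g \<in> G" "h \<in> G"
  shows "v * z g h \<in> normal_span (m + {#g, h#})"
proof (rule normal_span_induct[where f = "\<lambda>v. v * z g h", OF assms(1)])
  show "a * z g h \<in> normal_span (m + {#g, h#})" if "a \<in> J m" for a
    by (rule J_in_normal_span, rule act_right[OF z_act[OF assms(2,3)] that]) (simp add: multiset_eq_iff)
next
  fix s ps
  assume s: "sorted s" "set s \<subseteq> G" and ps: "distinct ps" "set ps \<subseteq> G \<times> G" and m: "mset s + zdeg ps = m"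
  let ?z = "z g h" and ?m = "m + {#g, h#}"
  show "mon s * zs ps * ?z \<in> normal_span ?m"
  proof (cases "(g, h) \<in> set ps")
    case False
    have "mon s * zs (ps @ [(g, h)]) \<in> normal_span ?m"
      by (rule normal_forms_in_normal_span) (use s ps m False assms in auto)
    then show ?thesis by (simp add: mult.assoc)
  next
    case True
    then obtain as bs where split: "ps = as @ (g, h) # bs" by (meson split_list)
    have as: "set as \<subseteq> G \<times> G" and bs: "set bs \<subseteq> G \<times> G" and dist: "distinct (as @ bs)"
      using ps split by auto
    have m': "?m = mset s + zdeg as + {#g, g, h, h#} + zdeg bs"
      unfolding m[symmetric] split by (simp add: multiset_eq_iff)
    define l where "l = mon s * zs as"
    have l: "l \<in> act (mset s + zdeg as)"
      unfolding l_def by (intro act_mult mon_act zs_act s as)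
    have lz: "l * ?z \<in> act (mset s + zdeg as + {#g, h#})"
      by (intro act_mult l z_act assms)
    have e0: "mon s * zs ps * ?z = (l * ?z) * (zs bs * ?z)"
      by (simp add: l_def split mult.assoc)
    have br: "br (zs bs) ?z \<in> J (zdeg bs + {#g, h#})"
      by (intro br_zs_in_J z_central hom_z bs assms)
    have e1: "congJ ?m (mon s * zs ps * ?z) (l * (?z * ?z) * zs bs) \<or> congJ ?m (mon s * zs ps * ?z) (- (l * (?z * ?z) * zs bs))"
    proof -
      have "congJ ?m ((l * ?z) * (zs bs * ?z)) ((l * ?z) * c)" if "congJ (zdeg bs + {#g, h#}) (zs bs * ?z) c" for c
        by (rule congJ_mult_left[OF that lz]) (simp add: m[symmetric] split multiset_eq_iff)
      from this[of "?z * zs bs"] this[of "- (?z * zs bs)"] congJ_swap[OF br hom_zs hom_z] show ?thesis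
        unfolding e0 by (auto simp: mult.assoc)
    qed
    have "congJ (mset s + zdeg as + {#g, g, h, h#}) (l * (?z * ?z)) (l * (z h h * z g g))"
      by (rule congJ_mult_left[OF _ l]) (use J_sq[OF assms(2,3)] in \<open>auto simp: congJ_def\<close>)
    then have e2: "congJ ?m (l * (?z * ?z) * zs bs) (l * (z h h * z g g) * zs bs)"
      by (rule congJ_mult_right[OF _ zs_act[OF bs]]) (simp add: m[symmetric] split multiset_eq_iff)
    have e3: "l * (z h h * z g g) * zs bs \<in> normal_span ?m"
    proof (cases "par g \<and> par h")
      case False
      then have "z g g = 0 \<or> z h h = 0" by (auto simp: z_def br_def od_x)
      then show ?thesis by (auto simp: add_subgroup_zero)
    next
      case True
      let ?g = "x g * x g" and ?h = "x h * x h" and ?r = "insort g (insort g s)"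
      let ?t = "insort h (insort h ?r)" and ?Y = "l * (x h * x h) * (x g * x g) * zs bs"
      have "congJ (mset s + zdeg as + {#h, h#}) (l * ?h) (?h * l)"
        unfolding l_def by (rule square_commutes) (use True s as assms in auto)
      then have "congJ (mset s + zdeg as + {#g, g, h, h#}) (l * ?h * ?g) (?h * l * ?g)"
        by (rule congJ_mult_right[OF _ act_mult[OF x_act x_act]]) (use assms in auto)
      also have "congJ (mset s + zdeg as + {#g, g, h, h#}) (?h * l * ?g) (?h * (?g * l))"
        unfolding mult.assoc[of ?h]
        by (rule congJ_mult_left[OF _ act_mult[OF x_act x_act]], unfold l_def, rule square_commutes[OF _ _ s(2) as refl])
           (use True assms in auto)
      finally have 1: "congJ (mset s + zdeg as + {#g, g, h, h#}) (l * ?h * ?g) (?h * (?g * l))" .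
      have 2: "congJ ?m (l * ?h * ?g * zs bs) (?h * (?g * l) * zs bs)"
        by (rule congJ_mult_right[OF 1 zs_act[OF bs]]) (simp add: m[symmetric] split multiset_eq_iff)
      then have 3: "congJ ?m ?Y (?h * (?g * mon s) * (zs as * zs bs))"
        by (simp add: l_def mult.assoc)
      have "congJ (mset s + {#g, g, h, h#}) (?h * (?g * mon s)) (?h * mon ?r)"
        by (rule congJ_mult_left[OF insort_square act_mult[OF x_act x_act]]) (use True s assms in auto)
      also have "congJ (mset s + {#g, g, h, h#}) (?h * mon ?r) (mon ?t)"
      proof -
        have eq: "mset s + {#g, g, h, h#} = add_mset h (add_mset h (mset ?r))"
          by (simp add: multiset_eq_iff)
        show ?thesis
          unfolding eq by (rule insort_square) (use True s assms in \<open>auto simp: set_insort_key\<close>)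
      qed
      finally have "congJ ?m (?h * (?g * mon s) * (zs as * zs bs)) (mon ?t * (zs as * zs bs))"
        by (rule congJ_mult_right[OF _ act_mult[OF zs_act[OF as] zs_act[OF bs]]]) (simp add: m[symmetric] split multiset_eq_iff)
      moreover have "mon ?t * zs (as @ bs) \<in> normal_span ?m"
        by (rule normal_forms_in_normal_span)
           (use s as bs dist assms in \<open>auto simp: sorted_insort set_insort_key m[symmetric] split multiset_eq_iff\<close>)
      ultimately have "?Y \<in> normal_span ?m" using congJ_in_normal_span[OF congJ_trans[OF 3]] by simp
      moreover have "l * (z h h * z g g) * zs bs = ?Y + ?Y + ?Y + ?Y"
        using True by (simp add: z_def br_def od_x algebra_simps)
      ultimately show ?thesis by (simp add: add_subgroup_add)
    qed
    from e1 show ?thesis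
    proof
      assume "congJ ?m (mon s * zs ps * ?z) (l * (?z * ?z) * zs bs)"
      then show ?thesis using e2 e3 congJ_trans congJ_in_normal_span by blast
    next
      assume "congJ ?m (mon s * zs ps * ?z) (- (l * (?z * ?z) * zs bs))"
      then show ?thesis using congJ_uminus[OF e2] add_subgroup_uminus[OF add_subgroup_normal_span e3] congJ_trans congJ_in_normal_span by blast
    qed
  qed
qed (simp_all add: left_diff_distrib)

text \<open>
  Insertion sort: each letter that \<open>x g\<close> passes contributes one commutator, and that commutator can
  be moved to the right end.
\<close>

lemma x_mult_mon:
  assumes "g \<in> G" "sorted s" "set s \<subseteq> G"
  shows "x g * mon s \<in> add_span ({mon (insort g s)} \<union>
     {mon t * z f h | t f h. sorted t \<and> set t \<subseteq> set s \<and> f \<in> G \<and> h \<in> G \<and> mset t + {#f, h#} = add_mset g (mset s)} \<union>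
     J (add_mset g (mset s)))" (is "_ \<in> add_span (?S s)")
  using assms(2,3)
proof (induction s)
  case Nil
  then show ?case by (auto intro: add_span.base)
next
  case (Cons h t)
  have h: "h \<in> G" "set t \<subseteq> G" "sorted t" and ht: "\<And>a. a \<in> set t \<Longrightarrow> h \<le> a" using Cons.prems by auto
  show ?case
  proof (cases "g \<le> h")
    case True
    then show ?thesis by (auto intro!: add_span.base)
  next
    case False
    have xt: "x h * (x g * mon t) \<in> add_span (?S (h # t))"
    proof (rule add_span_map[where f = "\<lambda>a. x h * a", OF Cons.IH])
      fix a assume "a \<in> ?S t"
      then consider "a = mon (insort g t)" | "a \<in> J (add_mset g (mset t))"
        | u f k where "a = mon u * z f k" "sorted u" "set u \<subseteq> set t" "f \<in> G" "k \<in> G"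
            "mset u + {#f, k#} = add_mset g (mset t)" by blast
      then show "x h * a \<in> add_span (?S (h # t))"
      proof cases
        case 1
        then show ?thesis using False by (auto intro!: add_span.base)
      next
        case 2
        then have "x h * a \<in> J (add_mset g (mset (h # t)))" using x_mult_J[OF h(1) 2] by (simp add: add_mset_commute)
        then show ?thesis by (intro add_span.base) simp
      next
        case 3
        have "sorted (h # u)" "set (h # u) \<subseteq> set (h # t)" using 3 ht by auto
        moreover have "mset (h # u) + {#f, k#} = add_mset g (mset (h # t))"
          using arg_cong[OF 3(6), of "add_mset h"] by (simp add: add_mset_commute)
        ultimately have "mon (h # u) * z f k \<in> ?S (h # t)" using 3(4,5) by blast
        then show ?thesis unfolding 3(1) by (intro add_span.base) (simp add: mult.assoc)
      qed
    qed (use h in \<open>auto simp: right_diff_distrib\<close>)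
    have zt: "z g h * mon t \<in> add_span (?S (h # t))"
    proof -
      have m: "add_mset g (mset (h # t)) = mset t + {#g, h#}" by simp
      have "br (mon t) (z g h) \<in> J (mset t + {#g, h#})"
        by (intro br_mon_in_J z_central hom_z h assms)
      then have "br (z g h) (mon t) \<in> J (add_mset g (mset (h # t)))"
        unfolding m by (rule br_swap_in_J) (intro hom_z hom_mon)+
      then have "congJ (add_mset g (mset (h # t))) (z g h * mon t) (mon t * z g h) \<or>
          congJ (add_mset g (mset (h # t))) (z g h * mon t) (- (mon t * z g h))"
        by (rule congJ_swap) (intro hom_z hom_mon)+
      moreover have "mon t * z g h \<in> add_span (?S (h # t))"
        by (rule add_span.base) (use h assms(1) in auto)
      ultimately show ?thesis
        by (rule congJ_sign_in_add_span[OF _ _ Un_upper2])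
    qed
    have sums: "z g h * mon t + x h * (x g * mon t) \<in> add_span (?S (h # t))"
      "z g h * mon t - x h * (x g * mon t) \<in> add_span (?S (h # t))"
      by (rule add_subgroup_add[OF add_subgroup_add_span zt xt] add_subgroup_diff[OF add_subgroup_add_span zt xt])+
    have "x g * mon (h # t) = z g h * mon t + x h * (x g * mon t) \<or> x g * mon (h # t) = z g h * mon t - x h * (x g * mon t)"
      using z_cases[of g h] by (elim disjE) (simp_all add: left_diff_distrib distrib_right mult.assoc)
    then show ?thesis
      by (elim disjE) (simp_all only: sums)
  qed
qed

lemma normal_span_mult_zs:
  assumes "v \<in> normal_span m" "set ps \<subseteq> G \<times> G"
  shows "v * zs ps \<in> normal_span (m + zdeg ps)"
  using assms
proof (induction ps arbitrary: v m)
  case (Cons p ps)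
  have "v * z (fst p) (snd p) * zs ps \<in> normal_span (m + {#fst p, snd p#} + zdeg ps)"
    by (intro Cons.IH normal_span_mult_z Cons.prems(1)) (use Cons.prems(2) in auto)
  then show ?case by (simp add: mult.assoc add_ac)
qed simp

lemma x_mult_normal_span:
  assumes "g \<in> G" "v \<in> normal_span m"
  shows "x g * v \<in> normal_span (add_mset g m)"
proof (rule normal_span_induct[where f = "\<lambda>v. x g * v", OF assms(2)])
  show "x g * a \<in> normal_span (add_mset g m)" if "a \<in> J m" for a
    by (rule J_in_normal_span, rule x_mult_J[OF assms(1) that])
next
  fix s ps
  assume s: "sorted s" "set s \<subseteq> G" and ps: "distinct ps" "set ps \<subseteq> G \<times> G" and m: "mset s + zdeg ps = m"
  have "x g * mon s * zs ps \<in> normal_span (add_mset g m)"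
  proof (rule add_span_map[where f = "\<lambda>a. a * zs ps", OF x_mult_mon[OF assms(1) s]], elim UnE)
    fix a assume "a \<in> {mon (insort g s)}"
    then show "a * zs ps \<in> normal_span (add_mset g m)"
      using s ps m assms(1) by (auto intro!: normal_forms_in_normal_span simp: sorted_insort set_insort_key)
  next
    fix a assume "a \<in> J (add_mset g (mset s))"
    then show "a * zs ps \<in> normal_span (add_mset g m)"
      by (intro J_in_normal_span act_right[OF zs_act[OF ps(2)]]) (use m in auto)
  next
    fix a assume "a \<in> {mon t * z f h |t f h. sorted t \<and> set t \<subseteq> set s \<and> f \<in> G \<and> h \<in> G
       \<and> mset t + {#f, h#} = add_mset g (mset s)}"
    then obtain t f h where a: "a = mon t * z f h" "sorted t" "set t \<subseteq> set s" "f \<in> G" "h \<in> G"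
      "mset t + {#f, h#} = add_mset g (mset s)" by blast
    have "mon t * zs [] \<in> normal_span (mset t + {#})"
      by (rule normal_forms_in_normal_span) (use a s in auto)
    then have "mon t * z f h * zs ps \<in> normal_span (mset t + {#f, h#} + zdeg ps)"
      by (intro normal_span_mult_zs normal_span_mult_z a ps) simp
    moreover have "mset t + {#f, h#} + zdeg ps = add_mset g m" unfolding a(6) m[symmetric] by simp
    ultimately show "a * zs ps \<in> normal_span (add_mset g m)" unfolding a(1) by (simp only:)
  qed (simp_all add: left_diff_distrib)
  then show "x g * (mon s * zs ps) \<in> normal_span (add_mset g m)" by (simp add: mult.assoc)
qed (simp_all add: right_diff_distrib)

lemma mon_in_normal_span: "set w \<subseteq> G \<Longrightarrow> mon w \<in> normal_span (mset w)"
proof (induction w)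
  case Nil
  show ?case using normal_forms_in_normal_span[of "[]" "[]" "{#}"] by simp
qed (simp add: x_mult_normal_span)

end

context gen_super_ring
begin

section \<open>Finite generation modulo an ideal of the lower central series\<close>

text \<open>
  The double bracket \<open>[b, [b a, a]]\<close> expands to \<open>[b, [b, a]] a \<plusminus> [b, a] [b, a]\<close> when \<open>a\<close> is even, since then
  \<open>[a, a] = 0\<close>.
\<close>

lemma even_square_in_M:
  assumes "\<not> par g"
  shows "br (x h) (x g) * br (x h) (x g) \<in> M 2"
proof -
  let ?a = "x g" and ?b = "x h"
  have a: "od ?a = 0" using assms by (simp add: od_x)
  have "br ?b (br ?b ?a) * ?a \<in> M 2" "br ?b (br (?b * ?a) ?a) \<in> M 2"
    unfolding numeral_2_eq_2
    by (intro M_mult_right D_subset_M br_in_D, simp)+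
  then have "br ?b (br ?b ?a) * ?a - br ?b (br (?b * ?a) ?a) \<in> M 2"
      "br ?b (br (?b * ?a) ?a) - br ?b (br ?b ?a) * ?a \<in> M 2"
    by (simp_all add: add_subgroup_diff)
  moreover have "br ?b ?a * br ?b ?a = br ?b (br (?b * ?a) ?a) - br ?b (br ?b ?a) * ?a \<or>
     br ?b ?a * br ?b ?a = br ?b (br ?b ?a) * ?a - br ?b (br (?b * ?a) ?a)"
    using hom_x[of h] a by (auto simp: homogeneous_def br_def od_mult algebra_simps)
  ultimately show ?thesis by auto
qed

lemma z_square_in_M: "z g h * z g h - z h h * z g g \<in> M 2"
proof -
  consider (odd) "par g" "par h" | (even_g) "\<not> par g" | (even_h) "\<not> par h" by blast
  then show ?thesis
  proof cases
    case odd
    \<comment> \<open>the expansion of \<open>[b, [b a, a]]\<close> again, now with the terms that contain \<open>[a, a]\<close> and \<open>[b, b]\<close>\<close>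
    let ?a = "x g" and ?b = "x h"
    have "z g h * z g h - z h h * z g g =
        - (br ?b (br (?b * ?a) ?a) + ?b * br ?b (br ?a ?a) + br ?b (br ?a ?b) * ?a)"
      using odd by (simp add: z_def br_def od_mult od_x algebra_simps)
    also have "\<dots> \<in> M 2"
      unfolding numeral_2_eq_2
      by (intro add_subgroup_uminus add_subgroup_add add_subgroup_P M_mult_left M_mult_right D_subset_M br_in_D) simp_all
    finally show ?thesis .
  next
    case even_g
    have "z g g = 0" using even_g by (simp add: z_def br_def od_x)
    moreover have "z g h * z g h = br (x h) (x g) * br (x h) (x g)"
      unfolding z_def using hom_br_swap[OF hom_x[of g] hom_x[of h]] by auto
    ultimately show ?thesis using even_square_in_M[OF even_g, of h] by simp
  next
    case even_h
    have "z h h = 0" using even_h by (simp add: z_def br_def od_x)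
    then show ?thesis using even_square_in_M[OF even_h, of g] by (simp add: z_def)
  qed
qed

text \<open>
  The relations, with their multidegrees, and their iterated brackets with generators. Brackets of all
  orders are needed to write a two-sided ideal as a left ideal.
\<close>

primrec Q :: "nat \<Rightarrow> ('g multiset \<times> 'a) set" where
  "Q 0 = (\<lambda>(f, g, h). ({#f, g, h#}, br (x f) (z g h))) ` (G \<times> G \<times> G) \<union>
         (\<lambda>(g, h). ({#g, g, h, h#}, z g h * z g h - z h h * z g g)) ` (G \<times> G)"
| "Q (Suc t) = (\<lambda>(f, d, q). (add_mset f d, br (x f) q)) ` (G \<times> Q t)"

lemma finite_Q: "finite (Q t)"
  by (induction t) (simp_all add: finite_G)

text \<open>
  Each element of \<open>Q t\<close> is small in two ways: it lies in \<open>M 2\<close>, which makes long products small, and,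
  being a \<open>t\<close>-fold bracket, in \<open>D t\<close>, which leaves only finitely many relevant \<open>t\<close>.
\<close>

lemma Q_subset_M2: "(d, q) \<in> Q t \<Longrightarrow> q \<in> M 2"
proof (induction t arbitrary: d q)
  case 0
  have "br (x f) (z g h) \<in> M 2" for f g h
    unfolding numeral_2_eq_2 z_def by (intro D_subset_M br_in_D) simp
  then show ?case using 0 z_square_in_M by auto
qed (auto intro: br_M)

lemma Q_subset_D: "(d, q) \<in> Q t \<Longrightarrow> q \<in> D t"
  by (induction t arbitrary: d q) (auto intro: br_in_D simp del: D.simps(2))

lemma hom_Q: "(d, q) \<in> Q t \<Longrightarrow> homogeneous q"
proof (induction t arbitrary: d q)
  case 0
  have "homogeneous (z g h * z g h - z h h * z g g)" for g h
  proof -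
    have "od (z g h * z g h - z h h * z g g) = 0"
      using hom_z[of g h] hom_x[of g] hom_x[of h]
      by (auto simp: homogeneous_def od_mult z_def od_br)
    then show ?thesis by (simp add: homogeneous_def)
  qed
  then show ?case using 0 by (auto intro: hom_br hom_x hom_z)
qed (auto intro: hom_br hom_x)

text \<open>
  The elements of multidegree \<open>m\<close> that are a word from \<open>W\<close> times a member of \<open>C\<close>; the first component of a
  member of \<open>C\<close> records its multidegree.
\<close>

definition left_words :: "'g list set \<Rightarrow> ('g multiset \<times> 'a) set \<Rightarrow> 'g multiset \<Rightarrow> 'a set" where
  "left_words W C m = {mon u * c | u d c. u \<in> W \<and> (d, c) \<in> C \<and> mset u + d = m}"

abbreviation "LW \<equiv> left_words (lists G)"
abbreviation "SW \<equiv> left_words {s \<in> lists G. sorted s}"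

definition graded_product :: "('g multiset \<times> 'a) set \<Rightarrow> ('g multiset \<times> 'a) set \<Rightarrow> ('g multiset \<times> 'a) set" where
  "graded_product B C = (\<lambda>((d, b), (e, c)). (d + e, b * c)) ` (B \<times> C)"

definition Q_below :: "nat \<Rightarrow> ('g multiset \<times> 'a) set" where
  "Q_below N = (\<Union>t<N. Q t)"

definition Q_ideal :: "nat \<Rightarrow> 'g multiset \<Rightarrow> 'a set" where
  "Q_ideal N m = add_span (LW (Q_below N) m \<union> M N)"

text \<open>
  Moving a generator from the right of \<open>q\<close> to its left costs a bracket \<open>[x g, q]\<close>. It is a relation of the
  next order, or, once the order reaches \<open>N\<close>, an element of \<open>M N\<close>.
\<close>

lemma Q_ideal_is_graded_ideal:
  assumes "N > 0"
  shows "graded_ideal od x par G (Q_ideal N)"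
proof
  show "add_subgroup (Q_ideal N m)" for m by (simp add: Q_ideal_def)
next
  fix g a m assume g: "g \<in> G" and a: "a \<in> Q_ideal N m"
  show "x g * a \<in> Q_ideal N (add_mset g m)"
  proof (rule add_span_map[where f = "\<lambda>a. x g * a", OF a[unfolded Q_ideal_def]])
    fix b assume "b \<in> LW (Q_below N) m \<union> M N"
    then show "x g * b \<in> Q_ideal N (add_mset g m)"
    proof
      assume "b \<in> M N"
      then show ?thesis unfolding Q_ideal_def by (intro add_span.base UnI2 M_mult_left)
    next
      assume "b \<in> LW (Q_below N) m"
      then obtain u d q where b: "b = mon u * q" "u \<in> lists G" "(d, q) \<in> Q_below N" "mset u + d = m"
        by (auto simp: left_words_def)
      then have "mon (g # u) * q \<in> LW (Q_below N) (add_mset g m)"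
        unfolding left_words_def using g by (intro CollectI exI[of _ "g # u"] exI[of _ d] exI[of _ q]) auto
      then show ?thesis unfolding Q_ideal_def b(1) by (intro add_span.base UnI1) (simp add: mult.assoc)
    qed
  qed (simp_all add: Q_ideal_def right_diff_distrib)
  show "a * x g \<in> Q_ideal N (add_mset g m)"
  proof (rule add_span_map[where f = "\<lambda>a. a * x g", OF a[unfolded Q_ideal_def]])
    fix b assume "b \<in> LW (Q_below N) m \<union> M N"
    then show "b * x g \<in> Q_ideal N (add_mset g m)"
    proof
      assume "b \<in> M N"
      then show ?thesis unfolding Q_ideal_def by (intro add_span.base UnI2 M_mult_right)
    next
      assume "b \<in> LW (Q_below N) m"
      then obtain u d q t where b: "b = mon u * q" "u \<in> lists G" "(d, q) \<in> Q t" "t < N" "mset u + d = m"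
        by (auto simp: left_words_def Q_below_def)
      have "mon (u @ [g]) * q \<in> LW (Q_below N) (add_mset g m)"
        unfolding left_words_def Q_below_def using g b
        by (intro CollectI exI[of _ "u @ [g]"] exI[of _ d] exI[of _ q]) auto
      then have 1: "mon u * (x g * q) \<in> Q_ideal N (add_mset g m)"
        unfolding Q_ideal_def by (intro add_span.base UnI1) (simp add: mult.assoc)
      have Q: "(add_mset g d, br (x g) q) \<in> Q (Suc t)" using b g by (auto intro!: image_eqI)
      have 2: "mon u * br (x g) q \<in> Q_ideal N (add_mset g m)"
      proof (cases "Suc t < N")
        case True
        then have "(add_mset g d, br (x g) q) \<in> Q_below N"
          unfolding Q_below_def using Q by blast
        then have "mon u * br (x g) q \<in> LW (Q_below N) (add_mset g m)"
          unfolding left_words_def using b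
          by (intro CollectI exI[of _ u] exI[of _ "add_mset g d"] exI[of _ "br (x g) q"]) auto
        then show ?thesis unfolding Q_ideal_def by (intro add_span.base UnI1)
      next
        case False
        then have "Suc t = N" using b by simp
        then have "br (x g) q \<in> D N" using Q_subset_D[OF Q] by simp
        then show ?thesis unfolding Q_ideal_def by (intro add_span.base UnI2 M_mult_left D_subset_M)
      qed
      have "mon u * q * x g = mon u * (x g * q) - mon u * br (x g) q \<or>
            mon u * q * x g = mon u * br (x g) q - mon u * (x g * q)"
        using hom_br_cases[OF hom_x[of g] hom_Q[OF b(3)]]
        by (elim disjE) (simp_all add: right_diff_distrib distrib_left mult.assoc)
      moreover have "add_subgroup (Q_ideal N (add_mset g m))" by (simp add: Q_ideal_def)
      ultimately show ?thesis
        unfolding b(1) using add_subgroup_diff[OF _ 1 2] add_subgroup_diff[OF _ 2 1] by metis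
    qed
  qed (simp_all add: Q_ideal_def left_diff_distrib)
next
  have *: "q \<in> Q_ideal N d" if "(d, q) \<in> Q 0" for d q
  proof -
    have "(d, q) \<in> Q_below N" unfolding Q_below_def using that assms by blast
    then show ?thesis
      unfolding Q_ideal_def left_words_def
      by (intro add_span.base UnI1 CollectI exI[of _ "[]"] exI[of _ d] exI[of _ q]) auto
  qed
  show "br (x f) (z g h) \<in> Q_ideal N {#f, g, h#}" if "f \<in> G" "g \<in> G" "h \<in> G" for f g h
  proof (rule *)
    show "({#f, g, h#}, br (x f) (z g h)) \<in> Q 0"
      unfolding Q.simps(1) by (rule UnI1, rule image_eqI[of _ _ "(f, g, h)"]) (use that in simp_all)
  qed
  show "z g h * z g h - z h h * z g g \<in> Q_ideal N {#g, g, h, h#}" if "g \<in> G" "h \<in> G" for g h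
  proof (rule *)
    show "({#g, g, h, h#}, z g h * z g h - z h h * z g g) \<in> Q 0"
      unfolding Q.simps(1) by (rule UnI2, rule image_eqI[of _ _ "(g, h)"]) (use that in simp_all)
  qed
qed

definition z_products :: "('g multiset \<times> 'a) set" where
  "z_products = (\<lambda>ps. (zdeg ps, zs ps)) ` {ps. set ps \<subseteq> G \<times> G \<and> distinct ps}"

lemma finite_z_products: "finite z_products"
  unfolding z_products_def by (intro finite_imageI finite_subset_distinct finite_cartesian_product finite_G)

lemma mon_in_layer:
  assumes "N > 0" "set w \<subseteq> G"
  shows "mon w \<in> add_span (SW z_products (mset w) \<union> (LW (Q_below N) (mset w) \<union> M N))"
proof -
  interpret graded_ideal od x par G "Q_ideal N" by (rule Q_ideal_is_graded_ideal[OF assms(1)])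
  show ?thesis
    using mon_in_normal_span[OF assms(2)] unfolding normal_span_def
  proof (rule add_span_least)
    have "normal_forms (mset w) = SW z_products (mset w)"
      unfolding normal_forms_def left_words_def z_products_def by (auto simp: subset_eq)
    then show "normal_forms (mset w) \<union> Q_ideal N (mset w) \<subseteq> add_span (SW z_products (mset w) \<union> (LW (Q_below N) (mset w) \<union> M N))"
      unfolding Q_ideal_def by (auto intro: add_span.base elim: add_span_mono)
  qed simp
qed

text \<open>
  Rewriting the word in front of \<open>c\<close> in normal form either stops at a sorted monomial or produces one
  more factor from \<open>Q_below N\<close>.
\<close>

lemma layer_step:
  assumes "N > 0" "a \<in> LW C m"
  shows "a \<in> add_span (SW (graded_product z_products C) m \<union> LW (graded_product (Q_below N) C) m \<union> M N)"
proof -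
  obtain u d c where a: "a = mon u * c" "set u \<subseteq> G" "(d, c) \<in> C" "mset u + d = m"
    using assms(2) by (auto simp: left_words_def)
  have shift: "b * c \<in> left_words W (graded_product B C) m" if b: "b \<in> left_words W B (mset u)" for b B W
  proof -
    obtain v e b' where "b = mon v * b'" "v \<in> W" "(e, b') \<in> B" "mset v + e = mset u"
      using b by (auto simp: left_words_def)
    then show ?thesis
      unfolding left_words_def graded_product_def using a
      by (intro CollectI exI[of _ v] exI[of _ "e + d"] exI[of _ "b' * c"])
         (auto simp: mult.assoc simp flip: add.assoc intro!: image_eqI[of _ _ "((e, b'), (d, c))"])
  qed
  show ?thesis
    unfolding a(1)
    by (rule add_span_map[where f = "\<lambda>b. b * c", OF mon_in_layer[OF assms(1) a(2)]])
       (auto simp: left_diff_distrib intro!: add_span.base dest: shift M_mult_right)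
qed

primrec Q_products :: "nat \<Rightarrow> nat \<Rightarrow> ('g multiset \<times> 'a) set" where
  "Q_products N 0 = {({#}, 1)}"
| "Q_products N (Suc s) = graded_product (Q_below N) (Q_products N s)"

lemma Q_products_subset_M: "(d, c) \<in> Q_products N (Suc s) \<Longrightarrow> c \<in> M (Suc (Suc s))"
proof (induction s arbitrary: d c)
  case 0
  then show ?case using Q_subset_M2 by (auto simp: graded_product_def Q_below_def numeral_2_eq_2)
next
  case (Suc s)
  from Suc.prems obtain e q e' c' where "c = q * c'" "(e, q) \<in> Q_below N" "(e', c') \<in> Q_products N (Suc s)"
    unfolding Q_products.simps(2)[of N "Suc s"] graded_product_def by auto
  then show ?case using Suc.IH Q_subset_M2 by (auto simp: Q_below_def intro: M2_mult_M)
qed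

lemma mon_in_layers:
  assumes "N > 0"
  shows "\<exists>C. finite C \<and> (\<forall>w. set w \<subseteq> G \<longrightarrow>
     mon w \<in> add_span (SW C (mset w) \<union> LW (Q_products N s) (mset w) \<union> M N))"
proof (induction s)
  case 0
  have "mon w \<in> LW (Q_products N 0) (mset w)" if "set w \<subseteq> G" for w
    using that by (auto simp: left_words_def)
  then show ?case by (intro exI[of _ "{}"]) (auto intro: add_span.base)
next
  case (Suc s)
  then obtain C where C: "finite C" "\<And>w. set w \<subseteq> G \<Longrightarrow>
     mon w \<in> add_span (SW C (mset w) \<union> LW (Q_products N s) (mset w) \<union> M N)" by blast
  let ?C = "C \<union> graded_product z_products (Q_products N s)"
  have fin: "finite (Q_products N s)" for s
    by (induction s) (auto simp: graded_product_def Q_below_def finite_Q)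
  have "mon w \<in> add_span (SW ?C (mset w) \<union> LW (Q_products N (Suc s)) (mset w) \<union> M N)" if "set w \<subseteq> G" for w
    using C(2)[OF that]
  proof (rule add_span_least)
    have "SW C (mset w) \<subseteq> SW ?C (mset w)" "SW (graded_product z_products (Q_products N s)) (mset w) \<subseteq> SW ?C (mset w)"
      by (auto simp: left_words_def)
    then show "SW C (mset w) \<union> LW (Q_products N s) (mset w) \<union> M N
        \<subseteq> add_span (SW ?C (mset w) \<union> LW (Q_products N (Suc s)) (mset w) \<union> M N)"
      by (auto intro: add_span.base dest!: layer_step[OF assms] elim!: add_span_mono)
  qed simp
  moreover have "finite ?C" by (simp add: C graded_product_def finite_z_products fin)
  ultimately show ?case by blast
qed

text \<open>
  After \<open>N\<close> steps the terms that have not stopped carry \<open>N\<close> factors from \<open>M 2\<close> and vanish modulo \<open>M N\<close>.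
\<close>

theorem finitely_generated_mod_M:
  "\<exists>C. finite C \<and> (\<forall>w. set w \<subseteq> G \<longrightarrow> mon w \<in> add_span (SW C (mset w) \<union> M N))"
proof (cases N)
  case 0
  then show ?thesis using D_subset_M by (intro exI[of _ "{}"]) (auto intro: add_span.base)
next
  case (Suc s)
  obtain C where C: "finite C" "\<And>w. set w \<subseteq> G \<Longrightarrow>
     mon w \<in> add_span (SW C (mset w) \<union> LW (Q_products N N) (mset w) \<union> M N)"
    using mon_in_layers[of N N] Suc by blast
  have "LW (Q_products N N) m \<subseteq> M N" for m
    unfolding left_words_def using Q_products_subset_M M_antimono[of N "Suc N"]
    by (auto simp: Suc intro!: M_mult_left)
  then have "SW C m \<union> LW (Q_products N N) m \<union> M N = SW C m \<union> M N" for m by blast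
  with C show ?thesis by auto
qed

lemma hom_br_cyclic:
  assumes "homogeneous a" "homogeneous b" "homogeneous e"
  shows "br (a * b) e = br a (b * e) + br b (e * a) \<or> br (a * b) e = br a (b * e) - br b (e * a)"
  using assms by (auto simp: homogeneous_def br_cyclic)

lemma br_mon_in_span_generators:
  assumes "set u \<subseteq> G" "set v \<subseteq> G"
  shows "br (mon u) (mon v) \<in> add_span {br (x g) (mon w) | g w. g \<in> G \<and> set w \<subseteq> G \<and> add_mset g (mset w) = mset u + mset v}"
  using assms
proof (induction u arbitrary: v)
  case Nil
  have "br 1 y = 0" for y by (simp add: br_def)
  then show ?case by (simp add: add_span.zero)
next
  case (Cons g u)
  let ?S = "{br (x k) (mon w) | k w. k \<in> G \<and> set w \<subseteq> G \<and> add_mset k (mset w) = mset (g # u) + mset v}"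
  have 1: "br (x g) (mon u * mon v) \<in> add_span ?S"
    by (intro add_span.base CollectI exI[of _ g] exI[of _ "u @ v"]) (use Cons.prems in auto)
  have "br (mon u) (mon (v @ [g])) \<in> add_span {br (x k) (mon w) | k w. k \<in> G \<and> set w \<subseteq> G \<and> add_mset k (mset w) = mset u + mset (v @ [g])}"
    by (rule Cons.IH) (use Cons.prems in auto)
  then have 2: "br (mon u) (mon v * x g) \<in> add_span ?S" by simp
  show ?case
    using hom_br_cyclic[OF hom_x[of g] hom_mon[of u] hom_mon[of v]] add_subgroup_add[OF add_subgroup_add_span 1 2] add_subgroup_diff[OF add_subgroup_add_span 1 2]
    by auto
qed

text \<open>
  The constant is the number of pairs of a generator and an element of \<open>C\<close>: given the multidegree, such a
  pair \<open>(g, c)\<close> leaves only one sorted monomial \<open>s\<close> for which \<open>[x g, s c]\<close> has this degree.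
\<close>

theorem bounded_brackets:
  "\<exists>K. \<forall>m. \<exists>E. finite E \<and> card E \<le> K \<and> (\<forall>u v. set u \<subseteq> G \<and> set v \<subseteq> G \<and> mset u + mset v = m \<longrightarrow>
     br (mon u) (mon v) \<in> add_span (E \<union> D (Suc r)))"
proof -
  obtain C where C: "finite C" "\<And>w. set w \<subseteq> G \<Longrightarrow> mon w \<in> add_span (SW C (mset w) \<union> M (2 * r))"
    using finitely_generated_mod_M by blast
  show ?thesis
  proof (intro exI[of _ "card (G \<times> C)"] allI)
    fix m
    define e where "e = (\<lambda>(g, d, c). br (x g) (mon (sorted_list_of_multiset (m - d - {#g#})) * c))"
    let ?E = "e ` (G \<times> C)"
    have gen: "br (x g) (mon w) \<in> add_span (?E \<union> D (Suc r))"
      if g: "g \<in> G" and w: "set w \<subseteq> G" "add_mset g (mset w) = m" for g w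
    proof (rule add_span_map[where f = "br (x g)", OF C(2)[OF w(1)]], elim UnE)
      fix a assume "a \<in> SW C (mset w)"
      then obtain s d c where a: "a = mon s * c" "sorted s" "(d, c) \<in> C" "mset s + d = mset w"
        by (auto simp: left_words_def)
      have "m - d - {#g#} = mset s" unfolding w(2)[symmetric] a(4)[symmetric] by simp
      then have "br (x g) a = e (g, d, c)"
        using a(2) by (simp add: e_def a(1) sorted_sort_id)
      then show "br (x g) a \<in> add_span (?E \<union> D (Suc r))" using g a(3) by (auto intro!: add_span.base)
    next
      fix a assume "a \<in> M (2 * r)"
      then show "br (x g) a \<in> add_span (?E \<union> D (Suc r))" by (intro add_span.base UnI2 br_M_D)
    qed simp_all
    have "br (mon u) (mon v) \<in> add_span (?E \<union> D (Suc r))"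
      if "set u \<subseteq> G" "set v \<subseteq> G" "mset u + mset v = m" for u v
      by (rule add_span_least[OF br_mon_in_span_generators[OF that(1,2)]]) (use gen that in auto)
    moreover have "finite ?E" "card ?E \<le> card (G \<times> C)"
      by (intro finite_imageI card_image_le finite_cartesian_product finite_G C(1))+
    ultimately show "\<exists>E. finite E \<and> card E \<le> card (G \<times> C) \<and> (\<forall>u v. set u \<subseteq> G \<and> set v \<subseteq> G \<and> mset u + mset v = m \<longrightarrow>
        br (mon u) (mon v) \<in> add_span (E \<union> D (Suc r)))"
      by blast
  qed
qed

end

section \<open>The free superring over the integers\<close>

text \<open>
  With concatenation as addition of exponents, finitely supported functions on words form the free
  ring. It has all generators at once; those outside \<open>gens n k\<close> are killed by the reduction map.
\<close>

instantiation list :: (type) monoid_add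
begin
definition zero_list :: "'a list" where "zero_list = []"
definition plus_list :: "'a list \<Rightarrow> 'a list \<Rightarrow> 'a list" where "plus_list = append"
instance by standard (simp_all add: zero_list_def plus_list_def)
end

text \<open>Any linear order on the generators serves for sorting monomials.\<close>

fun gen_code :: "gen \<Rightarrow> nat" where
  "gen_code (EvenGen i) = 2 * i"
| "gen_code (OddGen j) = 2 * j + 1"

lemma gen_code_inj: "gen_code a = gen_code b \<Longrightarrow> a = b"
  by (cases a; cases b) (simp_all, presburger+)

instantiation gen :: linorder
begin
definition less_eq_gen :: "gen \<Rightarrow> gen \<Rightarrow> bool" where "less_eq_gen a b \<longleftrightarrow> gen_code a \<le> gen_code b"
definition less_gen :: "gen \<Rightarrow> gen \<Rightarrow> bool" where "less_gen a b \<longleftrightarrow> gen_code a < gen_code b"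
instance by standard (auto simp: less_eq_gen_def less_gen_def intro: gen_code_inj)
end

type_synonym free_ring = "gen list \<Rightarrow>\<^sub>0 int"

definition odd_part :: "free_ring \<Rightarrow> free_ring" where
  "odd_part = Poly_Mapping.mapp (\<lambda>w c. if odd (odd_count w) then c else 0)"

lemma lookup_odd_part: "Poly_Mapping.lookup (odd_part a) w = (if odd (odd_count w) then Poly_Mapping.lookup a w else 0)"
  by (simp add: odd_part_def lookup_mapp when_def in_keys_iff)

lemma odd_part_diff: "odd_part (a - b) = odd_part a - odd_part b"
  by (rule poly_mapping_eqI) (simp add: lookup_odd_part lookup_minus)

lemma odd_part_word: "odd_part (frag_of w) = (if odd (odd_count w) then frag_of w else 0)"
  by (rule poly_mapping_eqI) (auto simp: lookup_odd_part lookup_single when_def)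

lemma odd_count_append: "odd_count (u @ v) = odd_count u + odd_count v"
  by (simp add: odd_count_def)

lemma word_times_word: "frag_of u * frag_of v = frag_of (u @ v :: 'a list)"
  by (simp add: mult_single plus_list_def)

lemma free_ring_induct: assumes "P 0" "\<And>w. P (frag_of w)" "\<And>a b. P a \<Longrightarrow> P b \<Longrightarrow> P (a - b)" shows "P a"
  by (rule frag_induction[of a UNIV]) (use assms in auto)

lemma odd_part_0 [simp]: "odd_part 0 = 0"
  using odd_part_diff[of 0 0] by simp

lemma additive_eqI:
  assumes "\<And>w. f (frag_of w) = g (frag_of w)" "\<And>a b. f (a - b) = f a - f b" "\<And>a b. g (a - b) = g a - g b"
  shows "f a = (g a :: 'b::ab_group_add)"
proof (induction a rule: free_ring_induct)
  case 1
  show ?case using assms(2)[of 0 0] assms(3)[of 0 0] by simp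
qed (simp_all add: assms)

lemma super_ring_odd_part: "super_ring odd_part"
proof
  fix x y :: free_ring
  show "odd_part (x + y) = odd_part x + odd_part y"
    by (rule poly_mapping_eqI) (simp add: lookup_odd_part lookup_add)
  show "odd_part (odd_part x) = odd_part x"
    by (rule poly_mapping_eqI) (simp add: lookup_odd_part)
  have "odd_part (frag_of u * y) = odd_part (frag_of u) * (y - odd_part y) + (frag_of u - odd_part (frag_of u)) * odd_part y" for u
    by (rule additive_eqI[where a = y and f = "\<lambda>y. odd_part (frag_of u * y)"])
       (simp_all add: odd_part_diff odd_part_word word_times_word odd_count_append algebra_simps)
  then show "odd_part (x * y) = odd_part x * (y - odd_part y) + (x - odd_part x) * odd_part y"
    by (rule additive_eqI[where a = x and f = "\<lambda>x. odd_part (x * y)"])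
       (simp_all add: odd_part_diff algebra_simps)
qed

interpretation F: gen_super_ring odd_part "\<lambda>g. frag_of [g]" is_odd_gen "gens n k" for n k
  by (intro gen_super_ring.intro gen_super_ring_axioms.intro super_ring_odd_part)
     (auto simp: gens_def odd_part_word odd_count_def)

lemma word_Nil: "frag_of ([] :: 'a list) = 1"
  by (metis single_one zero_list_def)

lemma mon_eq: "F.mon w = frag_of w"
  by (induction w) (simp_all add: word_times_word word_Nil)

lemma br_words: "F.br (frag_of u) (frag_of v) =
   (if odd (odd_count u) \<and> odd (odd_count v) then frag_of (u @ v) + frag_of (v @ u) else frag_of (u @ v) - frag_of (v @ u))"
  by (simp add: F.br_def odd_part_word word_times_word)

section \<open>Reduction modulo a prime\<close>

definition red :: "nat \<Rightarrow> nat \<Rightarrow> nat \<Rightarrow> free_ring \<Rightarrow> gen list \<Rightarrow> int" where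
  "red p n k a = (\<lambda>w. if w \<in> lists (gens n k) then Poly_Mapping.lookup a w mod int p else 0)"

locale reduction_mod_prime =
  fixes p n k :: nat
  assumes prime_p: "prime p"
begin

sublocale residues_prime p "residue_ring (int p)"
  by unfold_locales (use prime_p in auto)

abbreviation "Fp \<equiv> residue_ring (int p)"
abbreviation "A \<equiv> free_alg (residue_ring (int p)) n k"
abbreviation "\<phi> \<equiv> red p n k"
abbreviation "L i \<equiv> lcs (residue_ring (int p)) n k i"

sublocale A: module Fp A
  by (rule free_alg_module)

lemma Fp_simps [simp]: "\<zero>\<^bsub>Fp\<^esub> = 0" "\<one>\<^bsub>Fp\<^esub> = 1" "x \<oplus>\<^bsub>Fp\<^esub> y = (x + y) mod int p" "x \<otimes>\<^bsub>Fp\<^esub> y = (x * y) mod int p"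
    "carrier Fp = {0..int p - 1}"
  by (simp_all add: residue_ring_def)

lemma p_pos: "int p > 1"
  using m_gt_one .

lemma red_closed: "\<phi> a \<in> carrier A"
proof -
  have "supp Fp (\<phi> a) \<subseteq> Poly_Mapping.keys a"
    by (auto simp: supp_def red_def in_keys_iff split: if_splits)
  then have "finite (supp Fp (\<phi> a))" by (rule finite_subset) simp
  then show ?thesis
    using p_pos by (auto simp: free_alg_carrier supp_def red_def split: if_splits)
qed

lemma red_add: "\<phi> (a + b) = \<phi> a \<oplus>\<^bsub>A\<^esub> \<phi> b"
  by (auto simp: red_def free_alg_simps lookup_add mod_simps)

lemma red_cmul: "\<phi> (frag_cmul c a) = (c mod int p) \<odot>\<^bsub>A\<^esub> \<phi> a"
  by (auto simp: red_def free_alg_simps mod_simps)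

lemma red_diff: "\<phi> (a - b) = \<phi> a \<oplus>\<^bsub>A\<^esub> ((-1) mod int p) \<odot>\<^bsub>A\<^esub> \<phi> b"
proof -
  have "\<phi> (a + frag_cmul (-1) b) = \<phi> a \<oplus>\<^bsub>A\<^esub> ((-1) mod int p) \<odot>\<^bsub>A\<^esub> \<phi> b"
    unfolding red_add red_cmul ..
  then show ?thesis by simp
qed

lemma mod_closed: "c mod int p \<in> carrier Fp"
  using p_pos by simp

lemma red_0: "\<phi> 0 = \<zero>\<^bsub>A\<^esub>"
  by (auto simp: red_def free_alg_simps)

lemma red_mem_submodule:
  assumes "LinearCombinations.submodule Fp N A" "a \<in> add_span S" "\<And>s. s \<in> S \<Longrightarrow> \<phi> s \<in> N"
  shows "\<phi> a \<in> N"
proof -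
  interpret N: LinearCombinations.submodule Fp N A by (rule assms(1))
  from assms(2) show ?thesis
  proof induction
    case zero
    then show ?case unfolding red_0 by (rule N.zero_closed)
  next
    case (diff x y)
    then show ?case unfolding red_diff by (intro N.m_closed N.smult_closed mod_closed)
  qed (rule assms(3))
qed

lemma red_word: "\<phi> (frag_of u) = (if u \<in> lists (gens n k) then word Fp u else \<zero>\<^bsub>A\<^esub>)"
  using p_pos by (intro ext) (auto simp: red_def free_alg_simps word_def lookup_single when_def)

lemma neg_one_pow: "(\<ominus>\<^bsub>Fp\<^esub> \<one>\<^bsub>Fp\<^esub>) [^]\<^bsub>Fp\<^esub> (c :: nat) = (if odd c then (-1) mod int p else 1)"
proof -
  have "\<ominus>\<^bsub>Fp\<^esub> \<one>\<^bsub>Fp\<^esub> = (-1) mod int p" using neg_cong[of 1] p_pos by simp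
  then show ?thesis using pow_cong[of "-1" c] p_pos by auto
qed

lemma red_br_words:
  assumes "u \<in> lists (gens n k)" "v \<in> lists (gens n k)"
  shows "\<phi> (F.br (frag_of u) (frag_of v)) = word_bracket Fp n k u v"
proof -
  have uv: "u @ v \<in> lists (gens n k)" "v @ u \<in> lists (gens n k)" using assms by auto
  have w: "word Fp (u @ v) \<in> carrier A" "word Fp (v @ u) \<in> carrier A" using uv by (simp_all add: word_closed)
  have neg: "\<ominus>\<^bsub>A\<^esub> ((c mod int p) \<odot>\<^bsub>A\<^esub> x) = ((- c) mod int p) \<odot>\<^bsub>A\<^esub> x" if "x \<in> carrier A" for c x
    using A.smult_l_minus[OF mod_closed[of c] that] neg_cong[of c] by simp
  have one: "1 = 1 mod int p" using p_pos by simp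
  show ?thesis
  proof (cases "odd (odd_count u) \<and> odd (odd_count v)")
    case True
    have "\<ominus>\<^bsub>A\<^esub> (((-1) mod int p) \<odot>\<^bsub>A\<^esub> word Fp (v @ u)) = word Fp (v @ u)"
      unfolding neg[OF w(2)] using A.smult_one[OF w(2)] p_pos by simp
    moreover have "\<phi> (F.br (frag_of u) (frag_of v)) = word Fp (u @ v) \<oplus>\<^bsub>A\<^esub> word Fp (v @ u)"
      unfolding br_words if_P[OF True] red_add red_word if_P[OF uv(1)] if_P[OF uv(2)] ..
    ultimately show ?thesis
      using True by (simp only: word_bracket_def word_mult neg_one_pow a_minus_def) simp
  next
    case False
    have "\<ominus>\<^bsub>A\<^esub> (1 \<odot>\<^bsub>A\<^esub> word Fp (v @ u)) = ((-1) mod int p) \<odot>\<^bsub>A\<^esub> word Fp (v @ u)"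
      by (subst one, rule neg[OF w(2)])
    moreover have "\<phi> (F.br (frag_of u) (frag_of v)) = word Fp (u @ v) \<oplus>\<^bsub>A\<^esub> ((-1) mod int p) \<odot>\<^bsub>A\<^esub> word Fp (v @ u)"
      unfolding br_words if_not_P[OF False] red_diff red_word if_P[OF uv(1)] if_P[OF uv(2)] ..
    ultimately show ?thesis
      using False by (simp only: word_bracket_def word_mult neg_one_pow a_minus_def) simp
  qed
qed

lemma red_br_word_outside:
  assumes "u \<notin> lists (gens n k)"
  shows "\<phi> (F.br (frag_of u) b) = \<zero>\<^bsub>A\<^esub>"
proof (induction b rule: free_ring_induct)
  case 1
  then show ?case by (simp only: F.br_0 red_0)
next
  case (2 v)
  show ?case
    using assms by (cases "odd (odd_count u) \<and> odd (odd_count v)")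
      (simp_all add: br_words red_add red_diff red_word del: Fp_simps)
next
  case (3 a b)
  then show ?case
    unfolding F.br_diff_right red_diff by (simp only: A.smult_r_null mod_closed A.M.r_zero A.M.zero_closed)
qed

text \<open>
  The sum in the definition of the bracket runs over supports, which vary with the arguments. Over a
  common larger index set, additivity becomes visible.
\<close>

lemma sbracket_superset:
  assumes "a \<in> carrier A" "b \<in> carrier A" "finite S" "supp Fp a \<times> supp Fp b \<subseteq> S" "S \<subseteq> lists (gens n k) \<times> lists (gens n k)"
  shows "sbracket Fp n k a b = (\<Oplus>\<^bsub>A\<^esub>uv \<in> S. (a (fst uv) \<otimes>\<^bsub>Fp\<^esub> b (snd uv)) \<odot>\<^bsub>A\<^esub> word_bracket Fp n k (fst uv) (snd uv))"
proof -
  have ab: "a w \<in> carrier Fp" "b w \<in> carrier Fp" for w using assms by (auto simp only: free_alg_carrier)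
  show ?thesis
    unfolding sbracket_def
  proof (rule A.add.finprod_mono_neutral_cong_left)
    fix uv assume uv: "uv \<in> S - supp Fp a \<times> supp Fp b"
    then have "a (fst uv) = \<zero>\<^bsub>Fp\<^esub> \<or> b (snd uv) = \<zero>\<^bsub>Fp\<^esub>" by (cases uv) (auto simp: supp_def)
    then have "a (fst uv) \<otimes>\<^bsub>Fp\<^esub> b (snd uv) = \<zero>\<^bsub>Fp\<^esub>" using ab by auto
    moreover have "word_bracket Fp n k (fst uv) (snd uv) \<in> carrier A"
      using uv assms(5) by (intro word_bracket_closed) auto
    ultimately show "(a (fst uv) \<otimes>\<^bsub>Fp\<^esub> b (snd uv)) \<odot>\<^bsub>A\<^esub> word_bracket Fp n k (fst uv) (snd uv) = \<zero>\<^bsub>A\<^esub>"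
      by (simp only: A.smult_l_null)
  next
    show "(\<lambda>uv. (a (fst uv) \<otimes>\<^bsub>Fp\<^esub> b (snd uv)) \<odot>\<^bsub>A\<^esub> word_bracket Fp n k (fst uv) (snd uv)) \<in> S \<rightarrow> carrier A"
      using assms(5) by (intro Pi_I A.smult_closed word_bracket_closed m_closed ab) auto
  qed (use assms in auto)
qed

lemma sbracket_linear_right:
  assumes "a \<in> carrier A" "b \<in> carrier A" "c \<in> carrier A" "r \<in> carrier Fp"
  shows "sbracket Fp n k a (b \<oplus>\<^bsub>A\<^esub> r \<odot>\<^bsub>A\<^esub> c) = sbracket Fp n k a b \<oplus>\<^bsub>A\<^esub> r \<odot>\<^bsub>A\<^esub> sbracket Fp n k a c"
proof -
  let ?d = "b \<oplus>\<^bsub>A\<^esub> r \<odot>\<^bsub>A\<^esub> c"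
  define S where "S = supp Fp a \<times> (supp Fp b \<union> supp Fp c \<union> supp Fp ?d)"
  have d: "?d \<in> carrier A" using assms by (intro A.add.m_closed A.smult_closed)
  have ab: "a w \<in> carrier Fp" "b w \<in> carrier Fp" "c w \<in> carrier Fp" for w using assms by (auto simp only: free_alg_carrier)
  have fin: "finite S" and sub: "S \<subseteq> lists (gens n k) \<times> lists (gens n k)"
    unfolding S_def using assms(1-3) d unfolding free_alg_carrier by blast+
  let ?w = "\<lambda>uv. word_bracket Fp n k (fst uv) (snd uv)"
  have w: "?w uv \<in> carrier A" if "uv \<in> S" for uv
    using that sub by (intro word_bracket_closed) auto
  let ?t = "\<lambda>e uv. (a (fst uv) \<otimes>\<^bsub>Fp\<^esub> e (snd uv)) \<odot>\<^bsub>A\<^esub> ?w uv"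
  have t: "?t e uv \<in> carrier A" if "uv \<in> S" "e \<in> {b, c}" for e uv
    using that ab by (intro A.smult_closed w m_closed) auto
  have eq: "sbracket Fp n k a e = (\<Oplus>\<^bsub>A\<^esub>uv \<in> S. ?t e uv)" if "e \<in> {b, c, ?d}" for e
    by (rule sbracket_superset) (use that assms d fin sub in \<open>auto simp only: S_def\<close>)
  have "sbracket Fp n k a ?d = (\<Oplus>\<^bsub>A\<^esub>uv \<in> S. ?t ?d uv)" by (rule eq) simp
  also have "\<dots> = (\<Oplus>\<^bsub>A\<^esub>uv \<in> S. ?t b uv \<oplus>\<^bsub>A\<^esub> r \<odot>\<^bsub>A\<^esub> ?t c uv)"
  proof (rule A.add.finprod_cong')
    fix uv assume uv: "uv \<in> S"
    have "a (fst uv) \<otimes>\<^bsub>Fp\<^esub> ?d (snd uv) = a (fst uv) \<otimes>\<^bsub>Fp\<^esub> b (snd uv) \<oplus>\<^bsub>Fp\<^esub> r \<otimes>\<^bsub>Fp\<^esub> (a (fst uv) \<otimes>\<^bsub>Fp\<^esub> c (snd uv))"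
      using ab assms(4) by (simp add: free_alg_simps r_distr m_lcomm del: Fp_simps)
    then show "?t ?d uv = ?t b uv \<oplus>\<^bsub>A\<^esub> r \<odot>\<^bsub>A\<^esub> ?t c uv"
      using ab assms(4) w[OF uv] by (simp only: A.smult_l_distr A.smult_assoc1 m_closed)
  qed (use t assms in \<open>auto simp del: Fp_simps\<close>)
  also have "\<dots> = (\<Oplus>\<^bsub>A\<^esub>uv \<in> S. ?t b uv) \<oplus>\<^bsub>A\<^esub> (\<Oplus>\<^bsub>A\<^esub>uv \<in> S. r \<odot>\<^bsub>A\<^esub> ?t c uv)"
    by (rule A.add.finprod_multf) (use t assms in \<open>auto simp del: Fp_simps\<close>)
  also have "(\<Oplus>\<^bsub>A\<^esub>uv \<in> S. r \<odot>\<^bsub>A\<^esub> ?t c uv) = r \<odot>\<^bsub>A\<^esub> (\<Oplus>\<^bsub>A\<^esub>uv \<in> S. ?t c uv)"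
    by (rule A.finsum_smult_ldistr[symmetric]) (use t assms fin in \<open>auto simp del: Fp_simps\<close>)
  finally show ?thesis using eq by simp
qed

lemma red_br_word:
  assumes u: "u \<in> lists (gens n k)"
  shows "\<phi> (F.br (frag_of u) b) = sbracket Fp n k (word Fp u) (\<phi> b)"
proof (induction b rule: free_ring_induct)
  have zero: "sbracket Fp n k (word Fp u) \<zero>\<^bsub>A\<^esub> = \<zero>\<^bsub>A\<^esub>"
  proof -
    have "supp Fp \<zero>\<^bsub>A\<^esub> = {}" by (simp add: supp_def free_alg_simps)
    then show ?thesis unfolding sbracket_def by (simp del: Fp_simps)
  qed
  {
    case 1
    show ?case unfolding F.br_0 red_0 zero ..
  next
    case (2 v)
    show ?case
    proof (cases "v \<in> lists (gens n k)")
      case True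
      have "\<one>\<^bsub>Fp\<^esub> \<noteq> \<zero>\<^bsub>Fp\<^esub>" by simp
      then show ?thesis
        unfolding red_br_words[OF u True] red_word if_P[OF True] by (rule sbracket_word[symmetric, OF _ u True])
    next
      case False
      then have "\<phi> (F.br (frag_of u) (frag_of v)) = \<zero>\<^bsub>A\<^esub>"
        by (cases "odd (odd_count u) \<and> odd (odd_count v)")
           (simp_all add: br_words red_add red_diff red_word del: Fp_simps)
      then show ?thesis unfolding red_word if_not_P[OF False] zero .
    qed
  next
    case (3 a b)
    show ?case
      unfolding F.br_diff_right red_diff 3
      by (rule sbracket_linear_right[symmetric]) (intro word_closed u red_closed mod_closed)+
  }
qed

lemma red_D: "b \<in> F.D i \<Longrightarrow> \<phi> b \<in> L (Suc i)"
proof (induction i arbitrary: b)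
  case 0
  then show ?case by (simp add: red_closed)
next
  case (Suc i)
  interpret L: LinearCombinations.submodule Fp "L (Suc (Suc i))" A by (rule lcs_submodule)
  show ?case
  proof (rule red_mem_submodule[OF lcs_submodule, OF Suc.prems[unfolded F.D.simps]])
    fix s assume "s \<in> {F.br a b |a b. b \<in> F.D i}"
    then obtain a b where s: "s = F.br a b" and b: "\<phi> b \<in> L (Suc i)" using Suc.IH by blast
    have gens: "{sbracket Fp n k a b | a b. a \<in> carrier A \<and> b \<in> L (Suc i)} \<subseteq> carrier A"
      using sbracket_closed lcs_subset by blast
    show "\<phi> s \<in> L (Suc (Suc i))"
      unfolding s
    proof (induction a rule: free_ring_induct)
      case 1
      then show ?case unfolding F.br_0 red_0 by (rule L.zero_closed)
    next
      case (2 u)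
      show ?case
      proof (cases "u \<in> lists (gens n k)")
        case True
        have "sbracket Fp n k (word Fp u) (\<phi> b) \<in> {sbracket Fp n k a b | a b. a \<in> carrier A \<and> b \<in> L (Suc i)}"
          using True b word_closed by blast
        then show ?thesis
          unfolding red_br_word[OF True] lcs.simps(3) using A.in_own_span[OF gens] by blast
      next
        case False
        show ?thesis unfolding red_br_word_outside[OF False] by (rule L.zero_closed)
      qed
    next
      case (3 a b)
      then show ?case
        unfolding F.br_diff_left red_diff by (intro L.m_closed L.smult_closed mod_closed)
    qed
  qed
qed

lemma add_subgroup_cmul: "add_subgroup T \<Longrightarrow> a \<in> T \<Longrightarrow> frag_cmul c a \<in> (T :: free_ring set)"
proof (induction c rule: int_induct[where k = 0])
  case base
  then show ?case by (simp add: add_subgroup_zero)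
qed (simp_all add: frag_cmul_distrib frag_cmul_diff_distrib add_subgroup_add add_subgroup_diff)

definition brackets :: "gen multiset \<Rightarrow> free_ring set" where
  "brackets d = add_span {F.br (frag_of u) (frag_of v) | u v.
     u \<in> lists (gens n k) \<and> v \<in> lists (gens n k) \<and> mset u + mset v = d}"

definition proj :: "gen multiset \<Rightarrow> (gen list \<Rightarrow> int) \<Rightarrow> gen list \<Rightarrow> int" where
  "proj d a = (\<lambda>w. if mset w = d then a w else 0)"

text \<open>
  The elements whose component of degree \<open>d\<close> comes from integral brackets of words of total degree \<open>d\<close> form a
  submodule. It contains every bracket of two words, because such a bracket is homogeneous, and hence
  all of \<open>L 2\<close>.
\<close>

lemma proj_lcs2:
  assumes "a \<in> L 2"
  shows "proj d a \<in> \<phi> ` brackets d"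
proof -
  let ?N = "{a \<in> carrier A. proj d a \<in> \<phi> ` brackets d}"
  have N: "LinearCombinations.submodule Fp ?N A"
  proof (rule LinearCombinations.submodule.intro)
    show "module Fp A" by (rule free_alg_module)
    show "\<zero>\<^bsub>A\<^esub> \<in> ?N"
      using image_eqI[where f = \<phi> and x = 0 and A = "brackets d" and b = "proj d \<zero>\<^bsub>A\<^esub>"]
      by (simp add: brackets_def add_span.zero red_0 proj_def free_alg_simps A.M.zero_closed[unfolded free_alg_simps Fp_simps] del: A.M.zero_closed)
    show "v \<oplus>\<^bsub>A\<^esub> w \<in> ?N" if "v \<in> ?N" "w \<in> ?N" for v w
    proof -
      from that obtain \<alpha> \<beta> where ab: "\<alpha> \<in> brackets d" "\<beta> \<in> brackets d" "proj d v = \<phi> \<alpha>" "proj d w = \<phi> \<beta>" by auto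
      have "proj d (v \<oplus>\<^bsub>A\<^esub> w) = \<phi> (\<alpha> + \<beta>)"
        unfolding red_add ab(3,4)[symmetric] by (auto simp: proj_def free_alg_simps)
      moreover have "\<alpha> + \<beta> \<in> brackets d" using ab unfolding brackets_def by (intro add_subgroup_add add_subgroup_add_span)
      ultimately show ?thesis using that by (auto simp only: mem_Collect_eq A.M.add.m_closed)
    qed
    show "c \<odot>\<^bsub>A\<^esub> v \<in> ?N" if c: "c \<in> carrier Fp" and v: "v \<in> ?N" for c v
    proof -
      from v obtain \<alpha> where ab: "\<alpha> \<in> brackets d" "proj d v = \<phi> \<alpha>" by auto
      have "c mod int p = c" using c by simp
      then have "proj d (c \<odot>\<^bsub>A\<^esub> v) = \<phi> (frag_cmul c \<alpha>)"
        unfolding red_cmul ab(2)[symmetric] by (auto simp: proj_def free_alg_simps)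
      moreover have "frag_cmul c \<alpha> \<in> brackets d" using ab unfolding brackets_def by (intro add_subgroup_cmul add_subgroup_add_span)
      ultimately show ?thesis using v c by (auto simp only: mem_Collect_eq A.smult_closed)
    qed
  qed auto
  interpret N: LinearCombinations.submodule Fp ?N A by (rule N)
  have wb: "word_bracket Fp n k u v \<in> ?N" if uv: "u \<in> lists (gens n k)" "v \<in> lists (gens n k)" for u v
  proof -
    let ?b = "F.br (frag_of u) (frag_of v)"
    have eq: "word_bracket Fp n k u v = \<phi> ?b" using red_br_words[OF uv] by simp
    have supp: "\<phi> ?b w = 0" if "mset w \<noteq> mset u + mset v" for w
      using that by (auto simp: red_def br_words lookup_add lookup_minus lookup_single when_def)
    show ?thesis
    proof (cases "mset u + mset v = d")
      case True
      then have "proj d (\<phi> ?b) = \<phi> ?b" using supp by (auto simp: proj_def)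
      moreover have "?b \<in> brackets d" using True uv by (auto simp: brackets_def intro!: add_span.base)
      ultimately show ?thesis unfolding eq using red_closed by auto
    next
      case False
      then have "proj d (\<phi> ?b) = \<phi> 0" using supp by (auto simp: proj_def red_def)
      moreover have "0 \<in> brackets d" by (simp add: brackets_def add_span.zero)
      ultimately show ?thesis unfolding eq using red_closed by auto
    qed
  qed
  have "sbracket Fp n k a b \<in> ?N" if "a \<in> carrier A" "b \<in> carrier A" for a b
  proof -
    have fin: "finite (supp Fp a \<times> supp Fp b)" and sub: "supp Fp a \<times> supp Fp b \<subseteq> lists (gens n k) \<times> lists (gens n k)"
      and ab: "\<And>w. a w \<in> carrier Fp" "\<And>w. b w \<in> carrier Fp"
      using that unfolding free_alg_carrier by blast+
    have "(\<Oplus>\<^bsub>A\<^esub>uv \<in> S. f uv) \<in> ?N" if "finite S" "\<And>uv. uv \<in> S \<Longrightarrow> f uv \<in> ?N" for S f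
      using that
    proof (induction S)
      case (insert s S)
      then have "f \<in> S \<rightarrow> carrier A" "f s \<in> carrier A" using N.subset by blast+
      then have "(\<Oplus>\<^bsub>A\<^esub>uv \<in> insert s S. f uv) = f s \<oplus>\<^bsub>A\<^esub> (\<Oplus>\<^bsub>A\<^esub>uv \<in> S. f uv)"
        by (intro A.M.finsum_insert insert.hyps)
      moreover have "f s \<in> ?N" "(\<Oplus>\<^bsub>A\<^esub>uv \<in> S. f uv) \<in> ?N" using insert by blast+
      ultimately show ?case using N.m_closed by (simp only:)
    next
      case empty
      then show ?case using N.zero_closed by (simp only: A.M.finsum_empty)
    qed
    note sum_in_N = this
    show ?thesis
      unfolding sbracket_def
    proof (rule sum_in_N[OF fin])
      fix uv assume "uv \<in> supp Fp a \<times> supp Fp b"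
      then have "fst uv \<in> lists (gens n k)" "snd uv \<in> lists (gens n k)" using sub by auto
      then show "(a (fst uv) \<otimes>\<^bsub>Fp\<^esub> b (snd uv)) \<odot>\<^bsub>A\<^esub> word_bracket Fp n k (fst uv) (snd uv) \<in> ?N"
        by (intro N.smult_closed wb m_closed ab)
    qed
  qed
  then have "{sbracket Fp n k a b | a b. a \<in> carrier A \<and> b \<in> L (Suc 0)} \<subseteq> ?N" by auto
  from A.span_is_subset[OF this N] assms show ?thesis by (auto simp: numeral_2_eq_2)
qed

definition degree_of :: "(gen \<Rightarrow> nat) \<Rightarrow> gen multiset" where
  "degree_of m = (\<Sum>g\<in>gens n k. replicate_mset (m g) g)"

lemma mset_eq_degree:
  assumes "w \<in> lists (gens n k)" "\<forall>g\<in>gens n k. count_list w g = m g"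
  shows "mset w = degree_of m"
proof (rule multiset_eqI)
  fix g
  have fin: "finite (gens n k)" by (simp add: gens_def)
  have "count (degree_of m) g = (if g \<in> gens n k then m g else 0)"
    using fin by (simp add: degree_of_def count_sum)
  moreover have "count (mset w) g = count_list w g" by (induction w) auto
  moreover have "g \<notin> set w" if "g \<notin> gens n k" using that assms(1) by auto
  ultimately show "count (mset w) g = count (degree_of m) g"
    using assms(2) by (auto simp: count_list_0_iff)
qed

lemma homog_lcs2:
  assumes "a \<in> L 2" "a \<in> homog Fp n k m"
  shows "a \<in> \<phi> ` brackets (degree_of m)"
proof -
  have "a w = 0" if "mset w \<noteq> degree_of m" for w
  proof (rule ccontr)
    assume "a w \<noteq> 0"
    then have "w \<in> supp Fp a" by (simp add: supp_def)
    then have "w \<in> lists (gens n k)" "\<forall>g\<in>gens n k. count_list w g = m g"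
      using assms(2) unfolding homog_def free_alg_carrier by blast+
    then show False using mset_eq_degree that by blast
  qed
  then have "proj (degree_of m) a = a" by (auto simp: proj_def)
  then show ?thesis using proj_lcs2[OF assms(1), of "degree_of m"] by simp
qed

end

section \<open>Dimension of a multidegree component\<close>

text \<open>
  The spanning set \<open>E\<close> need not lie in the subspace \<open>N\<close>, so \<open>N\<close> is not obviously generated by \<open>card E\<close> elements. But
  independent subsets of \<open>N\<close> have at most \<open>card E\<close> elements, and a maximal one generates \<open>N\<close>.
\<close>

lemma (in vectorspace) dim_le_card_spanning:
  assumes N: "LinearCombinations.submodule K N V" and E: "finite E" "E \<subseteq> carrier V" and span: "N \<subseteq> span E"
  shows "vectorspace.fin_dim K (vs N) \<and> vectorspace.dim K (vs N) \<le> card E"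
proof -
  interpret N: LinearCombinations.submodule K N V by (rule N)
  have sub: "LinearCombinations.submodule K (span E) V" by (rule span_is_submodule[OF E(2)])
  have vsN: "vectorspace K (vs N)"
    by (intro vectorspace.intro submodule_is_module N field_axioms)
  have vsU: "vectorspace K (vs (span E))"
    by (intro vectorspace.intro submodule_is_module sub field_axioms)
  interpret N': vectorspace K "vs N" by (rule vsN)
  interpret U: vectorspace K "vs (span E)" by (rule vsU)
  have EU: "E \<subseteq> span E" by (rule in_own_span[OF E(2)])
  have bound: "card B \<le> card E" if B: "finite B" "B \<subseteq> N" "N'.lin_indpt B" for B
  proof (rule U.li_smaller_than_gen)
    have "lin_indpt B" using B(3) span_li_not_depend(2)[OF B(2) N] by simp
    then show "U.lin_indpt B" using span_li_not_depend(2)[OF _ sub, of B] B(2) span by auto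
    show "U.gen_set E" using span_li_not_depend(1)[OF EU sub] by simp
  qed (use B span E EU in auto)
  have "\<exists>B. finite B \<and> maximal B (\<lambda>S. S \<subseteq> carrier (vs N) \<and> N'.lin_indpt S)"
  proof (rule maximal_exists[where N = "card E" and B = "{}"])
    show "finite A \<and> card A \<le> card E" if "A \<subseteq> carrier (vs N) \<and> N'.lin_indpt A" for A
    proof (cases "finite A")
      case True
      then show ?thesis using bound that by auto
    next
      case False
      then obtain B where B: "B \<subseteq> A" "finite B" "card B = Suc (card E)"
        by (metis infinite_arbitrarily_large)
      then have "N'.lin_indpt B" using that N'.subset_li_is_li by blast
      then show ?thesis using bound[of B] B that by auto
    qed
    show "{} \<subseteq> carrier (vs N) \<and> N'.lin_indpt {}" by (auto simp: N'.lin_dep_def)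
  qed
  then obtain B where B: "finite B" "maximal B (\<lambda>S. S \<subseteq> carrier (vs N) \<and> N'.lin_indpt S)" by blast
  then have gen: "N'.gen_set B" by (intro N'.max_li_is_gen)
  have BN: "B \<subseteq> carrier (vs N)" "N'.lin_indpt B" using B(2) by (auto simp: maximal_def)
  have "N'.fin_dim" unfolding N'.fin_dim_def using B(1) BN(1) gen by blast
  moreover have "N'.dim \<le> card B" by (rule N'.gen_ge_dim[OF B(1) BN(1) gen])
  moreover have "card B \<le> card E" using bound B(1) BN by simp
  ultimately show ?thesis by linarith
qed

context reduction_mod_prime
begin

text \<open>
  The component is viewed inside the quotient of the whole algebra by the next term of the series. There it lies in the
  span of the classes of the reductions of \<open>E\<close>: the summands from \<open>D i\<close> reduce to elements of that term.
\<close>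

lemma Bquot_dim_le:
  assumes i: "i \<ge> 2" and E: "finite E"
    and span: "\<And>u v. set u \<subseteq> gens n k \<Longrightarrow> set v \<subseteq> gens n k \<Longrightarrow> mset u + mset v = degree_of m \<Longrightarrow>
       F.br (frag_of u) (frag_of v) \<in> add_span (E \<union> F.D i)"
  shows "vectorspace.fin_dim Fp (Bquot_comp Fp n k i m) \<and> vectorspace.dim Fp (Bquot_comp Fp n k i m) \<le> card E"
proof -
  let ?H = "L (Suc i)"
  let ?W = "quotient_module A ?H"
  let ?q = "\<lambda>a. ?H +>\<^bsub>A\<^esub> a"
  let ?C = "?q ` (L i \<inter> homog Fp n k m)"
  interpret H: LinearCombinations.submodule Fp ?H A by (rule lcs_submodule)
  interpret S: abelian_subgroup ?H A by (rule A.submodule_abelian_subgroup[OF lcs_submodule])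
  interpret W: vectorspace Fp ?W
    by (intro vectorspace.intro A.quotient_module lcs_submodule is_field)
  have car: "carrier ?W = ?q ` carrier A" by (auto simp: quotient_module_def A_RCOSETS_def')
  have q_add: "?q (a \<oplus>\<^bsub>A\<^esub> b) = ?q a \<oplus>\<^bsub>?W\<^esub> ?q b" if "a \<in> carrier A" "b \<in> carrier A" for a b
    using S.a_rcos_sum[OF that] by (simp add: quotient_module_def)
  have q_smult: "?q (c \<odot>\<^bsub>A\<^esub> a) = c \<odot>\<^bsub>?W\<^esub> ?q a" if "c \<in> carrier Fp" "a \<in> carrier A" for c a
    using A.smult_coset[OF lcs_submodule that] by simp
  have q_zero: "?q a = \<zero>\<^bsub>?W\<^esub>" if "a \<in> ?H" for a
    using S.a_rcos_const[OF that] by (simp add: quotient_module_def)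
  have eq: "Bquot_comp Fp n k i m = ?W\<lparr>carrier := ?C\<rparr>"
  proof -
    have "set_add (A\<lparr>carrier := L i\<rparr>) = set_add A"
      by (intro ext) (simp add: set_add_def set_mult_def)
    moreover have "(+>\<^bsub>A\<lparr>carrier := L i\<rparr>\<^esub>) = (+>\<^bsub>A\<^esub>)"
      by (intro ext) (simp add: a_r_coset_def r_coset_def)
    ultimately show ?thesis
      by (simp add: Bquot_comp_def Bquot_def quotient_module_def)
  qed
  interpret C: module Fp "?W\<lparr>carrier := ?C\<rparr>" using Bquot_comp_module[of n k i m] unfolding eq .
  have sub: "LinearCombinations.submodule Fp ?C ?W"
  proof (rule LinearCombinations.submodule.intro)
    show "?C \<subseteq> carrier ?W" unfolding car using lcs_subset by blast
  qed (use W.module_axioms C.M.add.m_closed C.M.zero_closed C.smult_closed in simp_all)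
  have Eq: "(?q \<circ> \<phi>) ` E \<subseteq> carrier ?W" unfolding car using red_closed by auto
  define T where "T = W.span ((?q \<circ> \<phi>) ` E)"
  interpret T: LinearCombinations.submodule Fp T ?W
    unfolding T_def by (rule W.span_is_submodule[OF Eq])
  have "?C \<subseteq> T"
  proof
    fix c assume "c \<in> ?C"
    then obtain a where a: "a \<in> L i" "a \<in> homog Fp n k m" "c = ?q a" by blast
    have "L j \<subseteq> L 2" if "j \<ge> 2" for j
      using that by (induction rule: dec_induct) (use lcs_Suc_subset in blast)+
    then have "a \<in> L 2" using i a by blast
    then obtain \<alpha> where \<alpha>: "\<alpha> \<in> brackets (degree_of m)" "a = \<phi> \<alpha>" using homog_lcs2 a(2) by blast
    have "\<alpha> \<in> add_span (E \<union> F.D i)"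
      using \<alpha>(1) unfolding brackets_def by (rule add_span_least) (use span in auto)
    let ?N = "{a \<in> carrier A. ?q a \<in> T}"
    have "\<phi> \<alpha> \<in> ?N"
    proof (rule red_mem_submodule[OF _ \<open>\<alpha> \<in> add_span (E \<union> F.D i)\<close>])
      show "LinearCombinations.submodule Fp ?N A"
        by (rule LinearCombinations.submodule.intro)
           (auto simp: q_add q_smult q_zero free_alg_module simp del: Fp_simps)
      fix s assume "s \<in> E \<union> F.D i"
      then show "\<phi> s \<in> ?N"
      proof
        assume "s \<in> E"
        then show ?thesis using W.in_own_span[OF Eq] red_closed by (auto simp: T_def)
      next
        assume "s \<in> F.D i"
        then show ?thesis using q_zero[OF red_D] red_closed T.zero_closed by auto
      qed
    qed
    then show "c \<in> T" using a(3) \<alpha>(2) by simp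
  qed
  from W.dim_le_card_spanning[OF sub _ Eq this[unfolded T_def]] E card_image_le[OF E, of "?q \<circ> \<phi>"]
  show ?thesis unfolding eq by auto
qed

end

theorem theorem6p13:
  fixes n k i :: nat
  assumes "i \<ge> 2"
  shows "\<exists>K :: nat. \<forall>p :: nat. prime p \<longrightarrow> (\<forall>m :: gen \<Rightarrow> nat.
           vectorspace.fin_dim (residue_ring (int p)) (Bquot_comp (residue_ring (int p)) n k i m) \<and>
           vectorspace.dim (residue_ring (int p)) (Bquot_comp (residue_ring (int p)) n k i m) \<le> K)"
proof -
  obtain r where r: "i = Suc r" using assms by (cases i) auto
  obtain K where K: "\<And>d. \<exists>E. finite E \<and> card E \<le> K \<and> (\<forall>u v. set u \<subseteq> gens n k \<and> set v \<subseteq> gens n k \<and> mset u + mset v = d \<longrightarrow>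
     F.br (frag_of u) (frag_of v) \<in> add_span (E \<union> F.D (Suc r)))"
    using F.bounded_brackets[of n k r] unfolding mon_eq by blast
  show ?thesis
  proof (intro exI[of _ K] allI impI)
    fix p m assume "prime (p :: nat)"
    then interpret reduction_mod_prime p n k by unfold_locales
    from K[of "degree_of m"] obtain E where E: "finite E" "card E \<le> K"
      "\<forall>u v. set u \<subseteq> gens n k \<and> set v \<subseteq> gens n k \<and> mset u + mset v = degree_of m \<longrightarrow>
         F.br (frag_of u) (frag_of v) \<in> add_span (E \<union> F.D (Suc r))" by blast
    show "vectorspace.fin_dim Fp (Bquot_comp Fp n k i m) \<and> vectorspace.dim Fp (Bquot_comp Fp n k i m) \<le> K"
      using Bquot_dim_le[OF assms E(1), of m] E(2,3) unfolding r by fastforce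
  qed
qed

end
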